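(* Let $\mathbb{P}$ be a number field, let $n$ be a positive integer, and let $G=\langle x_1,\ldots,x_r\rangle$ be a finitely generated solvable-by-finite subgroup of $\mathrm{GL}(n,\mathbb{P})$. Let $Y$ be a finite subset of the unipotent radical $U(G)$, and let $N=\langle Y\rangle^G$ be the normal closure of $\langle Y\rangle$ in $G$ (so $N\leq U(G)$). Define subgroups $H_1\leq H_2\leq\cdots$ of $N$ as follows: $H_1=\langle Y\rangle$, and for $i\geq 1$, if $H_i=\langle y_{i1},\ldots,y_{is_i}\rangle$ then $$H_{i+1}=\langle\, y_{ij},\ y_{ij}^{x_k},\ y_{ij}^{x_k^{-1}} : 1\leq j\leq s_i,\ 1\leq k\leq r\,\rangle .$$ Let $t\ge 1$ be such that $\mathrm{rk}(H_t)=\mathrm{rk}(H_{t+1})$ (such a $t$ exists because $\mathrm{rk}(H_i)\leq \mathrm{rk}(H_{i+1})\leq\mathrm{rk}(N)$ for all $i$). Then $\mathrm{rk}(H_t)=\mathrm{rk}(N)$.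
   Context: A group is solvable-by-finite if it has a solvable normal subgroup of finite index. The unipotent radical $U(G)$ of $G\leq\mathrm{GL}(n,\mathbb{P})$ is the largest unipotent normal subgroup of $G$. Conjugation is written $y^x=x^{-1}yx$. A group $K$ has finite Prüfer rank $\mathrm{rk}(K)$ if each finitely generated subgroup of $K$ can be generated by $\mathrm{rk}(K)$ elements, and $\mathrm{rk}(K)$ is the least such integer; unipotent subgroups of $\mathrm{GL}(n,\mathbb{P})$ have finite Prüfer rank, so all the ranks in the claim are finite. *)

theory Defs
  imports "HOL-Analysis.Analysis" "HOL-Algebra.Algebra" "HOL-Library.Extended_Nat"
begin

definition number_field :: "'a::field_char_0 itself \<Rightarrow> bool" where
  "number_field _ \<longleftrightarrow>
     (\<exists>B. finite_dimensional_vector_space (\<lambda>(q::rat) (x::'a). of_rat q * x) B)"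

definition GL :: "('a::field ^ 'n ^ 'n) monoid" where
  "GL = \<lparr>carrier = {A. invertible A}, monoid.mult = (**), one = mat 1\<rparr>"

lemma group_GL: "group (GL :: ('a::field ^ 'n ^ 'n) monoid)"
proof (rule groupI)
  fix x :: "'a ^ 'n ^ 'n"
  assume "x \<in> carrier GL"
  then show "\<exists>y\<in>carrier GL. y \<otimes>\<^bsub>GL\<^esub> x = \<one>\<^bsub>GL\<^esub>"
    unfolding GL_def invertible_def by auto
qed (auto simp: GL_def invertible_mult matrix_mul_assoc, auto simp: invertible_def)

(* Powers of A - 1 are spelled out by iteration because the multiplication and
   power of the type class structure on vectors are componentwise. *)
definition unipotent_matrix :: "'a::field ^ 'n ^ 'n \<Rightarrow> bool" where
  "unipotent_matrix A \<longleftrightarrow> (\<exists>k. (((**) (A - mat 1)) ^^ k) (mat 1) = 0)"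

definition unipotent_radical :: "('a::field ^ 'n ^ 'n) set \<Rightarrow> ('a ^ 'n ^ 'n) set" where
  "unipotent_radical G =
     (GREATEST U. U \<lhd> (GL\<lparr>carrier := G\<rparr>) \<and> (\<forall>u\<in>U. unipotent_matrix u))"

definition solvable_by_finite :: "('a, 'b) monoid_scheme \<Rightarrow> bool" where
  "solvable_by_finite K \<longleftrightarrow>
     (\<exists>S. S \<lhd> K \<and> solvable (K\<lparr>carrier := S\<rparr>) \<and> finite (rcosets\<^bsub>K\<^esub> S))"

definition conjugate :: "('a, 'b) monoid_scheme \<Rightarrow> 'a \<Rightarrow> 'a \<Rightarrow> 'a" where
  "conjugate K y x = inv\<^bsub>K\<^esub> x \<otimes>\<^bsub>K\<^esub> y \<otimes>\<^bsub>K\<^esub> x"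

definition normal_closure :: "('a, 'b) monoid_scheme \<Rightarrow> 'a set \<Rightarrow> 'a set" where
  "normal_closure K S = \<Inter>{N. N \<lhd> K \<and> S \<subseteq> N}"

definition rank_at_most :: "('a, 'b) monoid_scheme \<Rightarrow> nat \<Rightarrow> bool" where
  "rank_at_most K r \<longleftrightarrow>
     (\<forall>S. finite S \<and> S \<subseteq> carrier K \<longrightarrow>
        (\<exists>T. finite T \<and> card T \<le> r \<and> T \<subseteq> carrier K \<and> generate K T = generate K S))"

(* The value is infinity if no finite bound exists. *)
definition pruefer_rank :: "('a, 'b) monoid_scheme \<Rightarrow> enat" where
  "pruefer_rank K = Inf {enat r | r. rank_at_most K r}"

end

theory Submission
  imports Defs "HOL-Computational_Algebra.Polynomial" "HOL-Number_Theory.Cong"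
begin

text \<open>The unipotent radical M of G is the set of elements acting trivially on all chief factors of
  the G-module of column vectors, and M - 1 lies in a nilpotent algebra J. A flag of rational
  subspaces of J filters every subgroup K of M with factors that embed into the rationals, and the
  Pruefer rank of K is the number of nonzero factors (the jumps of K). If H = H t and H (t + 1) have
  the same rank, they have the same jumps, and this forces H (t + 1) into the Zariski closure of H.
  So the closure of H is invariant under conjugation by the generators of G and contains N; since H
  is finitely generated, Mal'cev coordinates show that no subgroup of the closure of H has jumps
  outside those of H.\<close>

section \<open>Polynomial functions on nilpotent algebras\<close>

text \<open>The obstacle is that \<open>N\<close> need not be finitely generated and
  \<open>H t\<close> need not have finite index in it: for the group generated by diag(2, 1) and one
  transvection, \<open>N\<close> is the additive group of Z[1/2] while every \<open>H i\<close> is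
  cyclic. Commensurability of finitely generated groups therefore does not reach \<open>N\<close>.
  The Zariski closure does: it contains all unipotent roots of its elements, it is multiplicatively
  closed for formal reasons, and its stability under a conjugation can be tested on generators of
  \<open>H t\<close>. The topology must be the rational one, given by rational-valued functions.
  Rank counts dimension over the rationals, and polynomials over the number field itself would be
  too coarse: over Q(sqrt 2) the closure of the cyclic group of one transvection would be a full
  root group, of rank 2 instead of 1. The hypotheses enter at separate places. A number field has
  finite degree, which makes the flag finite. Solvability by finite yields a fixed vector theorem of
  Kolchin type, which puts every unipotent normal subgroup of \<open>G\<close> inside
  \<open>M\<close>; so a largest one exists and is \<open>M\<close>.\<close>

definition poly_seq :: "(nat \<Rightarrow> rat) \<Rightarrow> bool" where
  "poly_seq s \<longleftrightarrow> (\<exists>p. \<forall>n. s n = poly p (of_nat n))"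

lemma poly_seq_const: "poly_seq (\<lambda>n. q)"
  unfolding poly_seq_def by (rule exI[of _ "[:q:]"]) simp

lemma poly_seq_ident: "poly_seq of_nat"
  unfolding poly_seq_def by (rule exI[of _ "[:0, 1:]"]) simp

lemma poly_seq_add: "poly_seq s \<Longrightarrow> poly_seq t \<Longrightarrow> poly_seq (\<lambda>n. s n + t n)"
  unfolding poly_seq_def by (metis poly_add)

lemma poly_seq_mult: "poly_seq s \<Longrightarrow> poly_seq t \<Longrightarrow> poly_seq (\<lambda>n. s n * t n)"
  unfolding poly_seq_def by (metis poly_mult)

lemma poly_seq_sum: "finite A \<Longrightarrow> (\<And>j. j \<in> A \<Longrightarrow> poly_seq (s j)) \<Longrightarrow> poly_seq (\<lambda>n. \<Sum>j\<in>A. s j n)"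
  by (induction A rule: finite_induct) (auto intro: poly_seq_const poly_seq_add)

lemma poly_seq_gbinomial:
  assumes "poly_seq s" shows "poly_seq (\<lambda>n. s n gchoose k)"
proof -
  have "poly_seq (\<lambda>n. \<Prod>i<k. s n - of_nat i)"
  proof (induction k)
    case (Suc k)
    have "poly_seq (\<lambda>n. (\<Prod>i<k. s n - of_nat i) * (s n + (- of_nat k)))"
      by (intro poly_seq_mult Suc poly_seq_add assms poly_seq_const)
    then show ?case by simp
  qed (simp add: poly_seq_const)
  from poly_seq_mult[OF this poly_seq_const[of "1 / fact k"]]
  show ?thesis by (simp add: gbinomial_prod_rev atLeast0LessThan)
qed

lemma poly_seq_zero:
  assumes "poly_seq s" and "infinite {n. s n = 0}" shows "s n = 0"
proof -
  obtain p where p: "\<And>n. s n = poly p (of_nat n)" using assms(1) by (auto simp: poly_seq_def)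
  have "infinite (of_nat ` {n. s n = 0} :: rat set)"
    using assms(2) by (subst finite_image_iff) (auto simp: inj_on_def)
  moreover have "of_nat ` {n. s n = 0} \<subseteq> {x. poly p x = 0}" using p by auto
  ultimately have "infinite {x. poly p x = 0}" using finite_subset by blast
  then have "p = 0" using poly_roots_finite by blast
  then show ?thesis using p by simp
qed

text \<open>\<open>\<iota>\<close> makes the ring a rational algebra, and the common zero sets of
  \<open>c 0, ..., c (i - 1)\<close> in \<open>J\<close> form the flag. By \<open>c_mult\<close>,
  right multiplication by \<open>J\<close> moves each member of the flag into the next; with
  \<open>c_faithful\<close> this makes every product of \<open>d + 1\<close> elements of
  \<open>J\<close> vanish.\<close>

locale filtered_algebra =
  fixes \<iota> :: "rat \<Rightarrow> 'r::ring_1" and J :: "'r set" and c :: "nat \<Rightarrow> 'r \<Rightarrow> rat" and d :: nat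
  assumes iota_add: "\<iota> (p + q) = \<iota> p + \<iota> q"
    and iota_mult: "\<iota> (p * q) = \<iota> p * \<iota> q"
    and iota_one: "\<iota> 1 = 1"
    and iota_central: "a * \<iota> q = \<iota> q * a"
    and J_zero: "0 \<in> J"
    and J_add: "a \<in> J \<Longrightarrow> b \<in> J \<Longrightarrow> a + b \<in> J"
    and J_mult: "a \<in> J \<Longrightarrow> b \<in> J \<Longrightarrow> a * b \<in> J"
    and J_scale: "a \<in> J \<Longrightarrow> \<iota> q * a \<in> J"
    and c_add: "c i (a + b) = c i a + c i b"
    and c_scale: "c i (\<iota> q * a) = q * c i a"
    and c_mult: "a \<in> J \<Longrightarrow> b \<in> J \<Longrightarrow> \<forall>j<i. c j a = 0 \<Longrightarrow> c i (a * b) = 0"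
    and c_faithful: "a \<in> J \<Longrightarrow> \<forall>j<d. c j a = 0 \<Longrightarrow> a = 0"
begin

lemma iota_zero: "\<iota> 0 = 0"
  using iota_add[of 0 0] by simp

lemma iota_of_nat: "\<iota> (of_nat n) = of_nat n"
  by (induction n) (auto simp: iota_zero iota_add iota_one)

lemma iota_uminus: "\<iota> (- q) = - \<iota> q"
  using iota_add[of q "- q"] by (simp add: iota_zero eq_neg_iff_add_eq_0 add.commute)

lemma iota_of_int: "\<iota> (of_int z) = of_int z"
  by (cases z) (auto simp: iota_of_nat iota_uminus simp del: of_nat_Suc)

lemma J_uminus: "a \<in> J \<Longrightarrow> - a \<in> J"
  using J_scale[of a "- 1"] by (simp add: iota_uminus iota_one)

lemma J_power: "a \<in> J \<Longrightarrow> a ^ Suc n \<in> J"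
  by (induction n) (auto intro: J_mult)

lemma c_zero: "c i 0 = 0"
  using c_add[of i 0 0] by simp

lemma c_uminus: "c i (- a) = - c i a"
  using c_add[of i a "- a"] by (simp add: c_zero)

lemma c_diff: "c i (a - b) = c i a - c i b"
  using c_add[of i a "- b"] by (simp add: c_uminus)

lemma c_of_nat: "c i (of_nat n * a) = of_nat n * c i a"
  by (metis c_scale iota_of_nat)

lemma c_of_int: "c i (of_int n * a) = of_int n * c i a"
  by (metis c_scale iota_of_int)

lemma c_sum: "c i (sum f A) = (\<Sum>j\<in>A. c i (f j))"
  by (induction A rule: infinite_finite_induct) (auto simp: c_zero c_add)

definition lvl :: "nat \<Rightarrow> 'r \<Rightarrow> bool" where
  "lvl i a \<longleftrightarrow> (\<forall>j<i. c j a = 0)"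

lemma lvl_0: "lvl 0 a"
  by (simp add: lvl_def)

lemma lvl_Suc: "lvl (Suc i) a \<longleftrightarrow> lvl i a \<and> c i a = 0"
  by (auto simp: lvl_def less_Suc_eq)

lemma lvl_mono: "lvl i a \<Longrightarrow> j \<le> i \<Longrightarrow> lvl j a"
  by (auto simp: lvl_def)

lemma lvl_add: "lvl i a \<Longrightarrow> lvl i b \<Longrightarrow> lvl i (a + b)"
  by (auto simp: lvl_def c_add)

lemma lvl_mult: "a \<in> J \<Longrightarrow> b \<in> J \<Longrightarrow> lvl i a \<Longrightarrow> lvl (Suc i) (a * b)"
  unfolding lvl_def by (intro allI impI c_mult) auto

lemma lvl_power: "a \<in> J \<Longrightarrow> lvl n (a ^ Suc n)"
proof (induction n)
  case (Suc n)
  then have "lvl (Suc n) (a ^ Suc n * a)" by (intro lvl_mult J_power) auto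
  then show ?case by (metis power_Suc2)
qed (simp add: lvl_0)

lemma power_eq_0: "a \<in> J \<Longrightarrow> a ^ Suc d = 0"
  using lvl_power[of a d] J_power[of a d] c_faithful by (auto simp: lvl_def)

lemma mult_iota_mult: "u * (\<iota> q * a) * v = \<iota> q * (u * a * v)"
  by (metis iota_central mult.assoc)

text \<open>The power (1 + a)^t as a binomial series, truncated at \<open>d\<close> because a^(d+1)
  = 0 on \<open>J\<close>. Rational exponents occur later, when Mal'cev coordinates are divided off
  at points outside the group.\<close>

definition bin :: "rat \<Rightarrow> 'r \<Rightarrow> 'r" where
  "bin t a = (\<Sum>j\<le>d. \<iota> (t gchoose j) * a ^ j)"

lemma bin_0: "bin 0 a = 1"
proof -
  have "bin 0 a = (\<Sum>j\<le>d. if j = 0 then 1 else 0)"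
    unfolding bin_def by (intro sum.cong refl) (auto simp: iota_one iota_zero gbinomial_0 gr0_conv_Suc)
  then show ?thesis by simp
qed

lemma bin_add_1:
  assumes "a \<in> J" shows "bin (t + 1) a = bin t a * (1 + a)"
proof -
  \<comment> \<open>The extra top term is zero; it is added so that Pascal's rule can be applied
    after an index shift.\<close>
  have eq: "(\<Sum>j\<le>Suc d. \<iota> (s gchoose j) * a ^ j) = bin s a" for s
    using power_eq_0[OF assms] by (simp add: bin_def del: power_Suc)
  have "bin (t + 1) a = 1 + (\<Sum>j\<le>d. \<iota> (t + 1 gchoose Suc j) * a ^ Suc j)"
    unfolding eq[symmetric] sum.atMost_Suc_shift by (simp add: iota_one)
  also have "\<dots> = (1 + (\<Sum>j\<le>d. \<iota> (t gchoose Suc j) * a ^ Suc j)) + (\<Sum>j\<le>d. \<iota> (t gchoose j) * a ^ Suc j)"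
    unfolding gbinomial_Suc_Suc iota_add distrib_right sum.distrib by (simp add: algebra_simps)
  also have "1 + (\<Sum>j\<le>d. \<iota> (t gchoose Suc j) * a ^ Suc j) = bin t a"
    unfolding eq[symmetric] sum.atMost_Suc_shift by (simp add: iota_one)
  also have "(\<Sum>j\<le>d. \<iota> (t gchoose j) * a ^ Suc j) = bin t a * a"
    by (simp add: bin_def sum_distrib_right mult.assoc power_commutes)
  finally show ?thesis by (simp add: distrib_left)
qed

lemma bin_of_nat: "a \<in> J \<Longrightarrow> bin (of_nat n) a = (1 + a) ^ n"
proof (induction n)
  case (Suc n)
  then show ?case using bin_add_1[of a "of_nat n"] by (simp add: add.commute power_commutes)
qed (simp add: bin_0)

section \<open>Linear forms and polynomial functions\<close>

definition linear_form :: "('r \<Rightarrow> rat) \<Rightarrow> bool" where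
  "linear_form l \<longleftrightarrow> (\<forall>a b. l (a + b) = l a + l b) \<and> (\<forall>q a. l (\<iota> q * a) = q * l a)"

lemma linear_form_sum: "linear_form l \<Longrightarrow> l (sum f A) = (\<Sum>j\<in>A. l (f j))"
proof (induction A rule: infinite_finite_induct)
  case (infinite A)
  then have "l (0 + 0) = l 0 + l 0" unfolding linear_form_def by blast
  with infinite show ?case by simp
next
  case empty
  then have "l (0 + 0) = l 0 + l 0" unfolding linear_form_def by blast
  then show ?case by simp
qed (auto simp: linear_form_def)

lemma linear_form_c: "linear_form (c i)"
  by (simp add: linear_form_def c_add c_scale)

lemma linear_form_mult_left: "linear_form l \<Longrightarrow> linear_form (\<lambda>x. l (w * x))"
  unfolding linear_form_def by (metis distrib_left iota_central mult.assoc)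

text \<open>Translations on both sides are built in, which makes the class stable under translation and
  conjugation.\<close>

definition poly_fun :: "('r \<Rightarrow> rat) \<Rightarrow> bool" where
  "poly_fun f \<longleftrightarrow> (\<forall>u v. \<forall>a\<in>J. poly_seq (\<lambda>n. f (u * (1 + a) ^ n * v)))"

lemma poly_fun_const: "poly_fun (\<lambda>x. q)"
  by (simp add: poly_fun_def poly_seq_const)

lemma poly_fun_add: "poly_fun f \<Longrightarrow> poly_fun g \<Longrightarrow> poly_fun (\<lambda>x. f x + g x)"
  by (simp add: poly_fun_def poly_seq_add)

lemma poly_fun_mult: "poly_fun f \<Longrightarrow> poly_fun g \<Longrightarrow> poly_fun (\<lambda>x. f x * g x)"
  by (simp add: poly_fun_def poly_seq_mult)

lemma poly_fun_sum: "finite A \<Longrightarrow> (\<And>j. j \<in> A \<Longrightarrow> poly_fun (f j)) \<Longrightarrow> poly_fun (\<lambda>x. \<Sum>j\<in>A. f j x)"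
  by (simp add: poly_fun_def poly_seq_sum)

lemma poly_fun_gbinomial: "poly_fun f \<Longrightarrow> poly_fun (\<lambda>x. f x gchoose k)"
  by (simp add: poly_fun_def poly_seq_gbinomial)

lemma poly_fun_translate: "poly_fun f \<Longrightarrow> poly_fun (\<lambda>x. f (w * x * w'))"
  unfolding poly_fun_def
proof (intro allI ballI)
  fix u v a
  assume f: "\<forall>u v. \<forall>a\<in>J. poly_seq (\<lambda>n. f (u * (1 + a) ^ n * v))" and "a \<in> J"
  then have "poly_seq (\<lambda>n. f (w * u * (1 + a) ^ n * (v * w')))" by blast
  then show "poly_seq (\<lambda>n. f (w * (u * (1 + a) ^ n * v) * w'))" by (simp add: mult.assoc)
qed

text \<open>The truncated binomial expansion of (1 + a)^n has the coefficients n choose j, which are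
  polynomials in n of degree at most \<open>d\<close>.\<close>

lemma poly_fun_linear_form:
  assumes l: "linear_form l" shows "poly_fun l"
  unfolding poly_fun_def
proof (intro allI ballI)
  fix u v a assume a: "a \<in> J"
  have "l (u * (1 + a) ^ n * v) = (\<Sum>j\<le>d. (of_nat n gchoose j) * l (u * a ^ j * v))" for n
  proof -
    have "u * (1 + a) ^ n * v = (\<Sum>j\<le>d. \<iota> (of_nat n gchoose j) * (u * a ^ j * v))"
      unfolding bin_of_nat[OF a, symmetric] bin_def sum_distrib_left sum_distrib_right mult_iota_mult ..
    moreover have "l (\<iota> q * b) = q * l b" for q b using l by (simp add: linear_form_def)
    ultimately show ?thesis by (simp add: linear_form_sum[OF l])
  qed
  then show "poly_seq (\<lambda>n. l (u * (1 + a) ^ n * v))"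
    by (simp add: poly_seq_sum poly_seq_mult poly_seq_gbinomial poly_seq_ident poly_seq_const)
qed

section \<open>The rational Zariski closure of a multiplicatively closed set\<close>

definition zariski_closure :: "'r set \<Rightarrow> 'r set" where
  "zariski_closure S = {g. \<forall>f. poly_fun f \<longrightarrow> (\<forall>x\<in>S. f x = 0) \<longrightarrow> f g = 0}"

lemma zariski_closure_superset: "S \<subseteq> zariski_closure S"
  by (auto simp: zariski_closure_def)

lemma zariski_closure_vanish:
  "poly_fun f \<Longrightarrow> (\<And>x. x \<in> S \<Longrightarrow> f x = 0) \<Longrightarrow> g \<in> zariski_closure S \<Longrightarrow> f g = 0"
  by (auto simp: zariski_closure_def)

lemma zariski_closureI:
  "(\<And>f. poly_fun f \<Longrightarrow> (\<And>x. x \<in> S \<Longrightarrow> f x = 0) \<Longrightarrow> f g = 0) \<Longrightarrow> g \<in> zariski_closure S"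
  by (auto simp: zariski_closure_def)

text \<open>The usual two steps: for fixed x in \<open>S\<close>, left translation by x shows that
  \<open>f\<close> vanishes at x * h; then right translation by \<open>h\<close> lets x run over the
  closure.\<close>

lemma zariski_closure_mult:
  assumes S: "\<And>x y. x \<in> S \<Longrightarrow> y \<in> S \<Longrightarrow> x * y \<in> S"
    and g: "g \<in> zariski_closure S" and h: "h \<in> zariski_closure S"
  shows "g * h \<in> zariski_closure S"
proof (rule zariski_closureI)
  fix f assume f: "poly_fun f" and 0: "\<And>x. x \<in> S \<Longrightarrow> f x = 0"
  have "f (x * h) = 0" if "x \<in> S" for x
    using zariski_closure_vanish[OF poly_fun_translate[OF f, of x 1] _ h] 0 S that by simp
  then show "f (g * h) = 0"
    using zariski_closure_vanish[OF poly_fun_translate[OF f, of 1 h] _ g] by simp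
qed

lemma zariski_closure_power:
  assumes S: "\<And>x y. x \<in> S \<Longrightarrow> y \<in> S \<Longrightarrow> x * y \<in> S" "1 \<in> S"
    and g: "g \<in> zariski_closure S"
  shows "g ^ n \<in> zariski_closure S"
  by (induction n) (use S g zariski_closure_superset in \<open>auto intro: zariski_closure_mult\<close>)

text \<open>A polynomial vanishing at all multiples of m is zero.\<close>

lemma zariski_closure_root:
  assumes S: "\<And>x y. x \<in> S \<Longrightarrow> y \<in> S \<Longrightarrow> x * y \<in> S" "1 \<in> S"
    and g: "g - 1 \<in> J" "g ^ m \<in> zariski_closure S" "m > 0"
  shows "g \<in> zariski_closure S"
proof (rule zariski_closureI)
  fix f assume f: "poly_fun f" and 0: "\<And>x. x \<in> S \<Longrightarrow> f x = 0"
  let ?s = "\<lambda>n. f (1 * (1 + (g - 1)) ^ n * 1)"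
  have "?s n = 0" if "m dvd n" for n
  proof -
    from that obtain k where "n = m * k" by blast
    then show ?thesis
      using zariski_closure_vanish[OF f 0 zariski_closure_power[OF S g(2), of k]]
      by (simp add: power_mult)
  qed
  then have "range (\<lambda>k. m * k) \<subseteq> {n. ?s n = 0}" by auto
  moreover have "infinite (range (\<lambda>k. m * k))"
    using \<open>m > 0\<close> by (intro range_inj_infinite) (auto simp: inj_on_def)
  ultimately have inf: "infinite {n. ?s n = 0}" using finite_subset by blast
  have "poly_seq ?s" using f g(1) unfolding poly_fun_def by blast
  from poly_seq_zero[OF this inf, of 1] show "f g = 0" by simp
qed

text \<open>The polynomial sequence f(h * g^n) equals f(g^(n-1)) = 0 for n > 0, hence it vanishes at
  n = 0 too, where its value is f(h).\<close>

lemma zariski_closure_inverse: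
  assumes S: "\<And>x y. x \<in> S \<Longrightarrow> y \<in> S \<Longrightarrow> x * y \<in> S" "1 \<in> S"
    and g: "g - 1 \<in> J" "g \<in> zariski_closure S" and h: "h * g = 1"
  shows "h \<in> zariski_closure S"
proof (rule zariski_closureI)
  fix f assume f: "poly_fun f" and 0: "\<And>x. x \<in> S \<Longrightarrow> f x = 0"
  let ?s = "\<lambda>n. f (h * (1 + (g - 1)) ^ n * 1)"
  have "?s (Suc n) = 0" for n
    using zariski_closure_vanish[OF f 0 zariski_closure_power[OF S g(2), of n]] h
    by (simp add: mult.assoc[symmetric])
  then have "range Suc \<subseteq> {n. ?s n = 0}" by auto
  moreover have "infinite (range Suc)" by (intro range_inj_infinite) auto
  ultimately have inf: "infinite {n. ?s n = 0}" using finite_subset by blast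
  have "poly_seq ?s" using f g(1) unfolding poly_fun_def by blast
  from poly_seq_zero[OF this inf, of 0] show "f h = 0" by simp
qed

text \<open>In the application \<open>w\<close> is an element of \<open>G\<close> that is usually
  not unipotent; the two-sided translations built into \<open>poly_fun\<close> keep x -> w * x * w'
  continuous all the same.\<close>

lemma zariski_closure_conjugate:
  assumes S: "\<And>x. x \<in> S \<Longrightarrow> w * x * w' \<in> zariski_closure S" and g: "g \<in> zariski_closure S"
  shows "w * g * w' \<in> zariski_closure S"
proof (rule zariski_closureI)
  fix f assume f: "poly_fun f" and 0: "\<And>x. x \<in> S \<Longrightarrow> f x = 0"
  have "f (w * x * w') = 0" if "x \<in> S" for x
    using zariski_closure_vanish[OF f 0 S[OF that]] .
  then show "f (w * g * w') = 0"
    using zariski_closure_vanish[OF poly_fun_translate[OF f] _ g] by simp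
qed

text \<open>Multiplicatively closed lattices exist because there are only finitely many nonzero monomials
  in finitely many elements of J.\<close>

lemma clear_denominators:
  assumes "finite Q" shows "\<exists>D::nat. D > 0 \<and> (\<forall>q\<in>Q. of_nat D * (q::rat) \<in> \<int>)"
  using assms
proof (induction Q rule: finite_induct)
  case empty
  then show ?case by (intro exI[of _ 1]) auto
next
  case (insert q Q)
  then obtain D where D: "D > 0" "\<forall>q\<in>Q. of_nat D * q \<in> \<int>" by auto
  obtain a b where ab: "quotient_of q = (a, b)" by (cases "quotient_of q")
  then have b: "b > 0" "q = of_int a / of_int b"
    using quotient_of_denom_pos quotient_of_div by auto
  have "of_nat (nat b * D) * q = of_int (a * int D)" using b by simp
  then have "of_nat (nat b * D) * q \<in> \<int>" by (metis Ints_of_int)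
  moreover have "of_nat (nat b * D) * r \<in> \<int>" if "r \<in> Q" for r
    using Ints_mult[OF Ints_of_nat[of "nat b"], of "of_nat D * r"] D that by (simp add: mult.assoc)
  ultimately show ?case using D b by (intro exI[of _ "nat b * D"]) auto
qed

text \<open>The index is one less than the degree: \<open>monomials F n\<close> holds the products
  of n + 1 factors. It then equals the level that these products reach, so they vanish as soon as n
  \<ge> d.\<close>

fun monomials :: "'r set \<Rightarrow> nat \<Rightarrow> 'r set" where
  "monomials F 0 = F"
| "monomials F (Suc n) = (\<lambda>(a, b). a * b) ` (monomials F n \<times> F)"

lemma monomials_mult:
  "a \<in> monomials F m \<Longrightarrow> b \<in> monomials F n \<Longrightarrow> a * b \<in> monomials F (Suc (m + n))"
proof (induction n arbitrary: b)
  case (Suc n)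
  then obtain b' f where b: "b = b' * f" "b' \<in> monomials F n" "f \<in> F" by auto
  then have "a * b' \<in> monomials F (Suc (m + n))" using Suc by auto
  then show ?case using b by (force simp: mult.assoc[symmetric])
qed auto

lemma monomials_finite: "finite F \<Longrightarrow> finite (monomials F n)"
  by (induction n) auto

lemma monomials_lvl: "F \<subseteq> J \<Longrightarrow> monomials F n \<subseteq> {a \<in> J. lvl n a}"
  by (induction n) (auto intro!: lvl_0 J_mult lvl_mult)

lemma lattice_exists:
  assumes F: "finite F" "F \<subseteq> J"
  obtains R and D :: nat where "F \<subseteq> R" "0 \<in> R"
    "\<And>a b. a \<in> R \<Longrightarrow> b \<in> R \<Longrightarrow> a + b \<in> R"
    "\<And>a b. a \<in> R \<Longrightarrow> b \<in> R \<Longrightarrow> a * b \<in> R" "R \<subseteq> J" "D > 0"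
    "\<And>a i. a \<in> R \<Longrightarrow> i < d \<Longrightarrow> of_nat D * c i a \<in> \<int>"
proof -
  interpret Z: Modules.module "\<lambda>(z::int) (a::'r). of_int z * a"
    by unfold_locales (auto simp: algebra_simps)
  define S where "S = (\<Union>n\<in>{..d}. monomials F n)"
  define R where "R = Z.span S"
  have S: "finite S" "S \<subseteq> J"
    unfolding S_def using F monomials_finite monomials_lvl by blast+
  have big: "a = 0" if "a \<in> monomials F n" "n \<ge> d" for a n
    using monomials_lvl[OF F(2), of n] that c_faithful[of a] by (auto simp: lvl_def)
  have SS: "a * b \<in> R" if "a \<in> S" "b \<in> S" for a b
  proof -
    from that obtain m n where "a \<in> monomials F m" "b \<in> monomials F n" by (auto simp: S_def)
    then have ab: "a * b \<in> monomials F (Suc (m + n))" by (rule monomials_mult)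
    show ?thesis
    proof (cases "Suc (m + n) \<le> d")
      case True
      then show ?thesis unfolding R_def S_def using ab by (intro Z.span_base) blast
    next
      case False
      then have "a * b = 0" using big[OF ab] by simp
      then show ?thesis by (simp add: R_def Z.span_zero)
    qed
  qed
  obtain D where D: "D > 0" "\<forall>q\<in>(\<lambda>(i, a). c i a) ` ({..<d} \<times> S). of_nat D * q \<in> \<int>"
    using clear_denominators[of "(\<lambda>(i, a). c i a) ` ({..<d} \<times> S)"] S by blast
  show ?thesis
  proof
    show "F \<subseteq> R" unfolding R_def S_def using Z.span_superset by fastforce
    show "0 \<in> R" by (simp add: R_def Z.span_zero)
    show "a + b \<in> R" if "a \<in> R" "b \<in> R" for a b using that by (simp add: R_def Z.span_add)
    show "a * b \<in> R" if a: "a \<in> R" and b: "b \<in> R" for a b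
    proof -
      have *: "x * b \<in> R" if x: "x \<in> S" for x
        using b unfolding R_def
      proof (induction rule: Z.span_induct_alt)
        case (step z y w)
        have "x * (of_int z * y + w) = of_int z * (x * y) + x * w"
          by (simp add: distrib_left) (metis mult.assoc mult_of_int_commute)
        then show ?case using step SS[OF x] R_def Z.span_add Z.span_scale by metis
      qed (simp add: Z.span_zero)
      show ?thesis using a unfolding R_def
      proof (induction rule: Z.span_induct_alt)
        case (step z y w)
        then show ?case using *[OF step(1)] R_def Z.span_add Z.span_scale
          by (simp add: distrib_right mult.assoc)
      qed (simp add: Z.span_zero)
    qed
    show "R \<subseteq> J"
    proof
      fix a assume "a \<in> R" then show "a \<in> J" unfolding R_def
        by (induction rule: Z.span_induct_alt) (use S J_zero J_add J_scale iota_of_int in \<open>auto, metis subsetD\<close>)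
    qed
    show "D > 0" by fact
    show "of_nat D * c i a \<in> \<int>" if "a \<in> R" "i < d" for a i
      using that(1) unfolding R_def
    proof (induction rule: Z.span_induct_alt)
      case (step z y w)
      have "of_nat D * c i y \<in> \<int>" using D step(1) that(2) by auto
      then have "of_int z * (of_nat D * c i y) + of_nat D * c i w \<in> \<int>" using step by simp
      then show ?case by (simp add: c_add c_of_int algebra_simps)
    qed (simp add: c_zero)
  qed
qed

end

section \<open>Jumps of unipotent groups\<close>

text \<open>\<open>\<rho>\<close> represents the whole ambient group, not only a unipotent one. The
  subgroups with image in 1 + \<open>J\<close> are singled out by \<open>unip\<close>, and
  conjugation by other elements remains available.\<close>

locale filtered_group = filtered_algebra \<iota> J c d + group G
  for \<iota> :: "rat \<Rightarrow> 'r::ring_1" and J c d and G :: "('g, 'm) monoid_scheme" (structure) +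
  fixes \<rho> :: "'g \<Rightarrow> 'r"
  assumes rho_mult: "g \<in> carrier G \<Longrightarrow> h \<in> carrier G \<Longrightarrow> \<rho> (g \<otimes> h) = \<rho> g * \<rho> h"
    and rho_one: "\<rho> \<one> = 1"
    and rho_inj: "g \<in> carrier G \<Longrightarrow> \<rho> g = 1 \<Longrightarrow> g = \<one>"
begin

definition \<delta> :: "'g \<Rightarrow> 'r" where "\<delta> g = \<rho> g - 1"

definition unip :: "'g set \<Rightarrow> bool" where
  "unip K \<longleftrightarrow> subgroup K G \<and> (\<forall>g\<in>K. \<delta> g \<in> J)"

lemma rho_eq: "\<rho> g = 1 + \<delta> g"
  by (simp add: \<delta>_def)

lemma delta_mult: "g \<in> carrier G \<Longrightarrow> h \<in> carrier G \<Longrightarrow> \<delta> (g \<otimes> h) = \<delta> g + \<delta> h + \<delta> g * \<delta> h"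
  by (simp add: \<delta>_def rho_mult algebra_simps)

lemma delta_one: "\<delta> \<one> = 0"
  by (simp add: \<delta>_def rho_one)

lemma rho_pow: "g \<in> carrier G \<Longrightarrow> \<rho> (g [^] (n::nat)) = \<rho> g ^ n"
  by (induction n) (auto simp: rho_one rho_mult power_commutes)

lemma unipD:
  assumes "unip K"
  shows "\<And>g. g \<in> K \<Longrightarrow> g \<in> carrier G" "\<And>g. g \<in> K \<Longrightarrow> \<delta> g \<in> J" "\<one> \<in> K"
    "\<And>g h. g \<in> K \<Longrightarrow> h \<in> K \<Longrightarrow> g \<otimes> h \<in> K" "\<And>g. g \<in> K \<Longrightarrow> inv g \<in> K"
  using assms by (auto simp: unip_def subgroup.mem_carrier subgroup.one_closed
      subgroup.m_closed subgroup.m_inv_closed)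

lemma rho_image_one: "unip K \<Longrightarrow> 1 \<in> \<rho> ` K"
  using unipD(3)[of K] rho_one by (metis imageI)

lemma rho_image_mult:
  assumes K: "unip K" and "x \<in> \<rho> ` K" "y \<in> \<rho> ` K" shows "x * y \<in> \<rho> ` K"
proof -
  from assms(2,3) obtain g h where "g \<in> K" "h \<in> K" "x = \<rho> g" "y = \<rho> h" by blast
  then show ?thesis using unipD(1,4)[OF K] rho_mult[of g h] by (metis imageI)
qed

lemma unip_subgroup: "unip K \<Longrightarrow> subgroup H G \<Longrightarrow> H \<subseteq> K \<Longrightarrow> unip H"
  by (auto simp: unip_def)

lemma unip_generate: "unip K \<Longrightarrow> F \<subseteq> K \<Longrightarrow> unip (generate G F)"
  using generate_is_subgroup[of F] generate_subgroup_incl[of F K] subgroup.subset[of K G]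
  by (auto simp: unip_def)

lemma unip_nat_pow: "unip K \<Longrightarrow> g \<in> K \<Longrightarrow> g [^] (n::nat) \<in> K"
  by (induction n) (auto simp: unipD(3-4))

lemma unip_int_pow: "unip K \<Longrightarrow> g \<in> K \<Longrightarrow> g [^] (z::int) \<in> K"
  by (simp add: int_pow_def2 unip_nat_pow unipD(5) del: pow_nat)

context
  fixes K and i :: nat assumes K: "unip K"
begin

lemma lvl_delta_mult:
  assumes "g \<in> K" "h \<in> K" "lvl i (\<delta> g)" "lvl i (\<delta> h)"
  shows "lvl i (\<delta> (g \<otimes> h))"
  using assms unipD[OF K] by (auto simp: delta_mult intro!: lvl_add lvl_mono[OF lvl_mult])

text \<open>The term \<open>\<delta> g * \<delta> h\<close> lies one level deeper than
  \<open>\<delta> g\<close>. Hence \<open>c i\<close> is a homomorphism to the rationals on the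
  elements of level i; its kernel is the next level.\<close>

lemma c_delta_mult:
  assumes "g \<in> K" "h \<in> K" "lvl i (\<delta> g)"
  shows "c i (\<delta> (g \<otimes> h)) = c i (\<delta> g) + c i (\<delta> h)"
  using assms unipD[OF K] lvl_mult[of "\<delta> g" "\<delta> h" i] by (auto simp: delta_mult c_add lvl_Suc)

lemma c_delta_inv_le:
  assumes "g \<in> K" "lvl i (\<delta> g)" "j \<le> i"
  shows "c j (\<delta> (inv g)) = - c j (\<delta> g)"
proof -
  have "\<delta> g + \<delta> (inv g) + \<delta> g * \<delta> (inv g) = 0"
    using assms unipD[OF K] delta_mult[of g "inv g"] by (simp add: delta_one)
  moreover have "c j (\<delta> g * \<delta> (inv g)) = 0"
    using assms unipD[OF K] lvl_mult[of "\<delta> g" "\<delta> (inv g)" i] by (auto simp: lvl_def)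
  ultimately show ?thesis using c_add c_zero by (metis add.right_neutral eq_neg_iff_add_eq_0 add.commute)
qed

lemma lvl_delta_inv: "g \<in> K \<Longrightarrow> lvl i (\<delta> g) \<Longrightarrow> lvl i (\<delta> (inv g))"
  using c_delta_inv_le[of g] by (auto simp: lvl_def)

lemma delta_nat_pow:
  assumes "g \<in> K" "lvl i (\<delta> g)"
  shows "lvl i (\<delta> (g [^] (n::nat))) \<and> c i (\<delta> (g [^] n)) = of_nat n * c i (\<delta> g)"
proof (induction n)
  case 0
  then show ?case by (simp add: delta_one c_zero lvl_def)
next
  case (Suc n)
  then show ?case using assms lvl_delta_mult c_delta_mult unip_nat_pow[OF K] by (simp add: algebra_simps)
qed

lemma delta_int_pow:
  assumes "g \<in> K" "lvl i (\<delta> g)"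
  shows "lvl i (\<delta> (g [^] (z::int)))" "c i (\<delta> (g [^] z)) = of_int z * c i (\<delta> g)"
  using delta_nat_pow[OF assms] c_delta_inv_le lvl_delta_inv unip_nat_pow[OF K] assms
  by (auto simp: int_pow_def2 simp del: pow_nat)

end

text \<open>The recursion \<open>bin_add_1\<close>, run upwards and downwards from exponent 0,
  determines both sides. This identifies the values of \<open>bin\<close> at integer exponents with
  group elements.\<close>

lemma rho_int_pow:
  assumes K: "unip K" "g \<in> K" shows "\<rho> (g [^] (z::int)) = bin (of_int z) (\<delta> g)"
proof (induction z rule: int_induct[where k = 0])
  case base
  then show ?case by (simp add: bin_0 rho_one)
next
  case (step1 z)
  have "\<rho> (g [^] (z + 1)) = \<rho> (g [^] z) * \<rho> g"
    using unipD[OF K(1)] K(2) by (simp add: int_pow_mult rho_mult)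
  then show ?case using step1 bin_add_1[of "\<delta> g"] unipD[OF K(1)] K(2) by (simp add: rho_eq[of g])
next
  case (step2 z)
  have g: "g \<in> carrier G" "\<delta> g \<in> J" using unipD[OF K(1)] K(2) by auto
  have "bin (of_int z) (\<delta> g) = bin (of_int (z - 1)) (\<delta> g) * \<rho> g"
    using bin_add_1[OF g(2), of "of_int (z - 1)"] by (simp add: rho_eq[of g])
  then have "bin (of_int z) (\<delta> g) * \<rho> (inv g) = bin (of_int (z - 1)) (\<delta> g) * \<rho> (g \<otimes> inv g)"
    using g rho_mult[of g "inv g"] by (simp add: mult.assoc del: r_inv)
  then have "bin (of_int (z - 1)) (\<delta> g) = \<rho> (g [^] z) * \<rho> (inv g)"
    using g step2 by (simp add: rho_one)
  also have "\<dots> = \<rho> (g [^] (z - 1))"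
    using g by (simp add: int_pow_diff rho_mult)
  finally show ?case ..
qed

text \<open>The jumps of K are the nonzero graded pieces of the filtration of K by level, and their number
  is the Hirsch length of K.\<close>

definition jumps :: "'g set \<Rightarrow> nat set" where
  "jumps K = {i. i < d \<and> (\<exists>g\<in>K. lvl i (\<delta> g) \<and> c i (\<delta> g) \<noteq> 0)}"

lemma jumps_mono: "H \<subseteq> K \<Longrightarrow> jumps H \<subseteq> jumps K"
  by (auto simp: jumps_def)

lemma finite_jumps: "finite (jumps K)"
  by (simp add: jumps_def)

text \<open>A lattice that contains \<open>\<delta>\<close> of the generators and of their inverses
  contains \<open>\<delta>\<close> of the whole group, since \<open>\<delta> (g \<otimes> h)\<close>
  is a polynomial without constant term in \<open>\<delta> g\<close> and
  \<open>\<delta> h\<close>.\<close>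

lemma generate_bounded_denominators:
  assumes K: "unip K" and F: "finite F" "F \<subseteq> K"
  obtains D :: nat where "D > 0"
    "\<And>g i. g \<in> generate G F \<Longrightarrow> i < d \<Longrightarrow> of_nat D * c i (\<delta> g) \<in> \<int>"
proof -
  let ?F = "\<delta> ` (F \<union> (\<lambda>g. inv g) ` F)"
  have "finite ?F" "?F \<subseteq> J" using F unipD[OF K] by auto
  then obtain R and D :: nat where R: "?F \<subseteq> R" "0 \<in> R"
    "\<And>a b. a \<in> R \<Longrightarrow> b \<in> R \<Longrightarrow> a + b \<in> R"
    "\<And>a b. a \<in> R \<Longrightarrow> b \<in> R \<Longrightarrow> a * b \<in> R" "D > 0"
    "\<And>a i. a \<in> R \<Longrightarrow> i < d \<Longrightarrow> of_nat D * c i a \<in> \<int>"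
    by (rule lattice_exists) blast
  have "\<delta> g \<in> R" if "g \<in> generate G F" for g
    using that
  proof (induction rule: generate.induct)
    case (eng g h)
    have "F \<subseteq> carrier G" using F unipD(1)[OF K] by auto
    then have "g \<in> carrier G" "h \<in> carrier G" using eng generate_in_carrier by blast+
    then show ?case using eng R by (simp add: delta_mult)
  qed (use R(1,2) delta_one in auto)
  from that[OF R(5) R(6)[OF this]] show ?thesis .
qed

text \<open>The values of \<open>c i\<close> on the elements of level i form a subgroup of (1/D) Z,
  which is cyclic; \<open>s i\<close> realises a generator of it. The \<open>s i\<close> together
  are a Mal'cev basis of the finitely generated group.\<close>

lemma jump_generators:
  assumes K: "unip K" and F: "finite F" "F \<subseteq> K"
  obtains s where "\<And>i. i \<in> jumps (generate G F) \<Longrightarrow> s i \<in> generate G F \<and> lvl i (\<delta> (s i)) \<and> c i (\<delta> (s i)) \<noteq> 0"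
    "\<And>i g. i \<in> jumps (generate G F) \<Longrightarrow> g \<in> generate G F \<Longrightarrow> lvl i (\<delta> g) \<Longrightarrow>
      \<exists>z::int. c i (\<delta> g) = of_int z * c i (\<delta> (s i))"
proof -
  let ?H = "generate G F"
  have H: "unip ?H" by (rule unip_generate[OF K F(2)])
  obtain D :: nat where D: "D > 0" "\<And>g i. g \<in> ?H \<Longrightarrow> i < d \<Longrightarrow> of_nat D * c i (\<delta> g) \<in> \<int>"
    using generate_bounded_denominators[OF assms] by blast
  have "\<exists>s. s \<in> ?H \<and> lvl i (\<delta> s) \<and> c i (\<delta> s) \<noteq> 0 \<and>
      (\<forall>g\<in>?H. lvl i (\<delta> g) \<longrightarrow> (\<exists>z::int. c i (\<delta> g) = of_int z * c i (\<delta> s)))"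
    if i: "i \<in> jumps ?H" for i
  proof -
    \<comment> \<open>The floor is exact on the group by the choice of \<open>D\<close>; it only
      turns the rational value into an integer, so that a least positive value exists and Euclidean
      division applies to it.\<close>
    define f where "f g = \<lfloor>of_nat D * c i (\<delta> g)\<rfloor>" for g
    have f: "of_int (f g) = of_nat D * c i (\<delta> g)" if "g \<in> ?H" for g
      using D(2)[OF that] i unfolding f_def jumps_def by (metis (no_types, lifting) mem_Collect_eq floor_of_int Ints_cases)
    define P where "P g \<longleftrightarrow> g \<in> ?H \<and> lvl i (\<delta> g) \<and> f g > 0" for g
    have "\<exists>g. P g"
    proof -
      obtain g where g: "g \<in> ?H" "lvl i (\<delta> g)" "c i (\<delta> g) \<noteq> 0" using i by (auto simp: jumps_def)
      have g': "inv g \<in> ?H" "lvl i (\<delta> (inv g))" "c i (\<delta> (inv g)) = - c i (\<delta> g)"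
        using g lvl_delta_inv[OF H] c_delta_inv_le[OF H] unipD[OF H] by auto
      have "of_int (f g) \<noteq> (0::rat)" "of_int (f (inv g)) = (- of_int (f g) :: rat)"
        using f[OF g(1)] f[OF g'(1)] g g' D(1) by auto
      then have "f g > 0 \<or> f (inv g) > 0"
        by (metis linorder_neqE neg_0_less_iff_less of_int_0_eq_iff of_int_eq_iff of_int_minus)
      then show ?thesis using g g' unfolding P_def by blast
    qed
    then obtain s where s: "P s" and min: "\<And>g. P g \<Longrightarrow> nat (f s) \<le> nat (f g)"
      using ex_has_least_nat[of P _ "\<lambda>g. nat (f g)"] by blast
    have sH: "s \<in> ?H" "lvl i (\<delta> s)" "f s > 0" using s by (auto simp: P_def)
    have "\<exists>z::int. c i (\<delta> g) = of_int z * c i (\<delta> s)" if g: "g \<in> ?H" "lvl i (\<delta> g)" for g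
    proof -
      define z where "z = f g div f s"
      define h where "h = g \<otimes> s [^] (- z)"
      have h: "h \<in> ?H" "lvl i (\<delta> h)" "c i (\<delta> h) = c i (\<delta> g) - of_int z * c i (\<delta> s)"
        unfolding h_def using g sH delta_int_pow[OF H, of s i "- z"] unip_int_pow[OF H]
        by (auto simp: c_delta_mult[OF H] intro!: unipD(4)[OF H] lvl_delta_mult[OF H])
      have "of_int (f h) = (of_int (f g - z * f s) :: rat)"
        using f[OF h(1)] f[OF g(1)] f[OF sH(1)] h(3) by (simp add: algebra_simps)
      then have "f h = f g - z * f s" by (metis of_int_eq_iff)
      then have fh: "f h = f g mod f s" by (simp add: z_def minus_div_mult_eq_mod)
      then have "f h \<ge> 0" "f h < f s" using sH(3) by auto
      then have "\<not> f h > 0" using min[of h] h(1,2) unfolding P_def by linarith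
      then have "of_int (f h) = (0::rat)" using \<open>f h \<ge> 0\<close> by simp
      then have "c i (\<delta> h) = 0" using f[OF h(1)] D(1) by simp
      then show ?thesis using h(3) by auto
    qed
    moreover have "c i (\<delta> s) \<noteq> 0" using f[OF sH(1)] sH(3) by auto
    ultimately show ?thesis using sH by blast
  qed
  then obtain s where "\<forall>i\<in>jumps ?H. s i \<in> ?H \<and> lvl i (\<delta> (s i)) \<and> c i (\<delta> (s i)) \<noteq> 0 \<and>
      (\<forall>g\<in>?H. lvl i (\<delta> g) \<longrightarrow> (\<exists>z::int. c i (\<delta> g) = of_int z * c i (\<delta> (s i))))" by metis
  then show ?thesis using that by blast
qed

text \<open>A finitely generated subgroup is generated by its Mal'cev basis, which has one element
  for each of its jumps, and these are among the jumps of \<open>K\<close>.\<close>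

lemma rank_at_most_jumps:
  assumes K: "unip K" shows "rank_at_most (G\<lparr>carrier := K\<rparr>) (card (jumps K))"
  unfolding rank_at_most_def
proof (intro allI impI)
  fix F assume "finite F \<and> F \<subseteq> carrier (G\<lparr>carrier := K\<rparr>)"
  then have F: "finite F" "F \<subseteq> K" by auto
  have sub: "subgroup K G" using K by (simp add: unip_def)
  let ?H = "generate G F"
  have H: "unip ?H" by (rule unip_generate[OF K F(2)])
  have HK: "?H \<subseteq> K" by (rule generate_subgroup_incl[OF F(2) sub])
  obtain s where s: "\<And>i. i \<in> jumps ?H \<Longrightarrow> s i \<in> ?H \<and> lvl i (\<delta> (s i)) \<and> c i (\<delta> (s i)) \<noteq> 0"
    and gen: "\<And>i g. i \<in> jumps ?H \<Longrightarrow> g \<in> ?H \<Longrightarrow> lvl i (\<delta> g) \<Longrightarrow>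
      \<exists>z::int. c i (\<delta> g) = of_int z * c i (\<delta> (s i))"
    using jump_generators[OF K F] by blast
  let ?T = "s ` jumps ?H"
  have T: "?T \<subseteq> ?H" using s by auto
  have subT: "subgroup (generate G ?T) G"
    using T unipD[OF H] by (intro generate_is_subgroup) auto
  \<comment> \<open>Downward induction on the level, from \<open>d\<close>, where only the identity
    is left, to 0, where there is no condition. Each step divides off a power of
    \<open>s i\<close>.\<close>
  have "g \<in> generate G ?T" if "g \<in> ?H" "lvl i (\<delta> g)" "i \<le> d" for g i
    using that(3,1,2)
  proof (induction i arbitrary: g rule: inc_induct)
    case base
    then have "\<delta> g = 0" using c_faithful unipD[OF H] by (auto simp: lvl_def)
    then have "g = \<one>" using rho_inj unipD[OF H] base by (simp add: \<delta>_def)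
    then show ?case by (simp add: generate.one)
  next
    case (step i)
    show ?case
    proof (cases "c i (\<delta> g) = 0")
      case True
      then show ?thesis using step by (simp add: lvl_Suc)
    next
      case False
      then have i: "i \<in> jumps ?H" using step by (auto simp: jumps_def)
      then obtain z :: int where z: "c i (\<delta> g) = of_int z * c i (\<delta> (s i))" using gen step by blast
      have si: "s i \<in> ?H" "lvl i (\<delta> (s i))" using s[OF i] by auto
      define h where "h = g \<otimes> s i [^] (- z)"
      have "h \<in> ?H" "lvl i (\<delta> h)" "c i (\<delta> h) = 0"
        unfolding h_def using step si z delta_int_pow[OF H si, of "- z"] unip_int_pow[OF H]
        by (auto simp: c_delta_mult[OF H] intro!: unipD(4)[OF H] lvl_delta_mult[OF H])
      then have h: "h \<in> generate G ?T" using step.IH by (simp add: lvl_Suc)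
      have car: "g \<in> carrier G" "s i \<in> carrier G" using step si unipD[OF H] by auto
      have "s i [^] z \<in> generate G ?T"
        using subgroup_int_pow_closed[OF subT generate.incl] i by blast
      then have "h \<otimes> s i [^] z \<in> generate G ?T" using h by (rule generate.eng[rotated])
      moreover have "h \<otimes> s i [^] z = g"
        using car by (simp add: h_def m_assoc int_pow_mult[symmetric])
      ultimately show ?thesis by simp
    qed
  qed
  then have "?H \<subseteq> generate G ?T" using lvl_0 by blast
  moreover have "generate G ?T \<subseteq> ?H" using generate_subgroup_incl[OF T] H by (simp add: unip_def)
  ultimately have eq: "generate G ?T = ?H" by blast
  have "card ?T \<le> card (jumps K)"
    using card_image_le[OF finite_jumps, of s ?H] card_mono[OF finite_jumps jumps_mono[OF HK]] by linarith
  moreover have "finite ?T" "?T \<subseteq> K" using T HK finite_jumps by auto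
  ultimately show "\<exists>T. finite T \<and> card T \<le> card (jumps K) \<and> T \<subseteq> carrier (G\<lparr>carrier := K\<rparr>) \<and>
      generate (G\<lparr>carrier := K\<rparr>) T = generate (G\<lparr>carrier := K\<rparr>) F"
    using eq generate_consistent[OF _ sub] F by (intro exI[of _ ?T]) auto
qed

text \<open>At each level the nonzero values of \<open>c i\<close> on \<open>K\<close> are rational
  multiples of a value on \<open>H\<close>. So some g^m agrees with an element of \<open>H\<close>
  up to a factor of deeper level, which is in the closure by induction; then g^m is in the closure,
  and so is its root g.\<close>

lemma jumps_eq_imp_closure:
  assumes H: "unip H" and K: "unip K" and HK: "H \<subseteq> K" and eq: "jumps K \<subseteq> jumps H"
  shows "\<rho> ` K \<subseteq> zariski_closure (\<rho> ` H)"
proof -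
  let ?Z = "zariski_closure (\<rho> ` H)"
  note S = rho_image_mult[OF H] rho_image_one[OF H]
  have "\<rho> g \<in> ?Z" if "g \<in> K" "lvl i (\<delta> g)" "i \<le> d" for g i
    using that(3,1,2)
  proof (induction i arbitrary: g rule: inc_induct)
    case base
    then have "\<delta> g = 0" using c_faithful unipD[OF K] by (auto simp: lvl_def)
    then show ?case using subsetD[OF zariski_closure_superset S(2)] by (simp add: rho_eq[of g])
  next
    case (step i)
    show ?case
    proof (cases "c i (\<delta> g) = 0")
      case True
      then show ?thesis using step by (simp add: lvl_Suc)
    next
      case False
      then have "i \<in> jumps K" using step by (auto simp: jumps_def)
      then obtain h where h: "h \<in> H" "lvl i (\<delta> h)" "c i (\<delta> h) \<noteq> 0" using eq by (auto simp: jumps_def)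
      \<comment> \<open>The ratio of the two values written as b / m, so that g^m and h^b have the
        same i-th coordinate.\<close>
      obtain b :: int and m :: nat where m: "m > 0" and bm: "of_nat m * c i (\<delta> g) = of_int b * c i (\<delta> h)"
      proof -
        obtain b n where "quotient_of (c i (\<delta> g) / c i (\<delta> h)) = (b, n)" by fastforce
        then have "n > 0" "c i (\<delta> g) / c i (\<delta> h) = of_int b / of_int n"
          using quotient_of_denom_pos quotient_of_div by auto
        then show ?thesis using that[of "nat n" b] h(3) by (simp add: field_simps)
      qed
      define k where "k = g [^] m \<otimes> h [^] (- b)"
      have hK: "h \<in> K" using h HK by blast
      have gn: "lvl i (\<delta> (g [^] m))" "c i (\<delta> (g [^] m)) = of_nat m * c i (\<delta> g)"
        using delta_nat_pow[OF K, of g i m] step by auto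
      have "k \<in> K" "lvl i (\<delta> k)" "c i (\<delta> k) = 0"
        unfolding k_def using step hK h gn bm delta_int_pow[OF K hK h(2), of "- b"] unip_nat_pow[OF K] unip_int_pow[OF K]
        by (auto simp: c_delta_mult[OF K] intro!: unipD(4)[OF K] lvl_delta_mult[OF K])
      then have k: "\<rho> k \<in> ?Z" using step.IH by (simp add: lvl_Suc)
      have car: "g \<in> carrier G" "h \<in> carrier G" using step hK unipD[OF K] by auto
      have "\<rho> (h [^] b) \<in> ?Z" using unip_int_pow[OF H h(1)] zariski_closure_superset by blast
      then have "\<rho> k * \<rho> (h [^] b) \<in> ?Z" using zariski_closure_mult[OF S(1) k] by blast
      also have "\<rho> k * \<rho> (h [^] b) = \<rho> (k \<otimes> h [^] b)"
        using car by (simp add: k_def rho_mult)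
      also have "k \<otimes> h [^] b = g [^] m"
        using car by (simp add: k_def m_assoc int_pow_mult[symmetric])
      finally have "\<rho> g ^ m \<in> ?Z" using car by (simp add: rho_pow)
      then show ?thesis using zariski_closure_root[OF S] unipD(2)[OF K step(4)] m
        by (simp add: \<delta>_def)
    qed
  qed
  then show ?thesis using lvl_0 by blast
qed

text \<open>The peeling map divides off one Mal'cev coordinate at a time. On the group generated by F all
  exponents are integers, so the group is preserved; hence on that group the i-th coordinate of the
  peeled element is a polynomial function which vanishes unless i is a jump.\<close>

lemma closure_imp_jumps:
  assumes U: "unip U" and F: "finite F" "F \<subseteq> U"
    and cl: "\<rho> ` K \<subseteq> zariski_closure (\<rho> ` generate G F)"
  shows "jumps K \<subseteq> jumps (generate G F)"
proof
  let ?H = "generate G F"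
  have H: "unip ?H" by (rule unip_generate[OF U F(2)])
  obtain s where s: "\<And>i. i \<in> jumps ?H \<Longrightarrow> s i \<in> ?H \<and> lvl i (\<delta> (s i)) \<and> c i (\<delta> (s i)) \<noteq> 0"
    and gen: "\<And>i g. i \<in> jumps ?H \<Longrightarrow> g \<in> ?H \<Longrightarrow> lvl i (\<delta> g) \<Longrightarrow>
      \<exists>z::int. c i (\<delta> g) = of_int z * c i (\<delta> (s i))"
    using jump_generators[OF U F] by blast
  \<comment> \<open>Left multiplication by the power of \<open>s j\<close> that cancels the j-th
    coordinate. At a general point x the exponent is only rational, hence \<open>bin\<close>; at
    indices that are not jumps nothing is done.\<close>
  define peel where "peel = rec_nat (\<lambda>x. x) (\<lambda>j p x. if j \<in> jumps ?H
    then bin (- c j (p x - 1) / c j (\<delta> (s j))) (\<delta> (s j)) * p x else p x)"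
  have peel_0: "peel 0 = (\<lambda>x. x)" by (simp add: peel_def)
  have peel_Suc: "peel (Suc j) x = (if j \<in> jumps ?H
    then bin (- c j (peel j x - 1) / c j (\<delta> (s j))) (\<delta> (s j)) * peel j x else peel j x)" for j x
    by (simp add: peel_def)
  have inH: "\<exists>h'\<in>?H. peel j (\<rho> h) = \<rho> h' \<and> lvl j (\<delta> h')" if "h \<in> ?H" "j \<le> d" for j h
    using that(2)
  proof (induction j)
    case 0
    then show ?case using that by (auto simp: peel_0 lvl_0)
  next
    case (Suc j)
    then obtain h' where h': "h' \<in> ?H" "peel j (\<rho> h) = \<rho> h'" "lvl j (\<delta> h')" by auto
    show ?case
    proof (cases "j \<in> jumps ?H")
      case True
      then obtain z :: int where z: "c j (\<delta> h') = of_int z * c j (\<delta> (s j))" using gen h' by blast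
      have sj: "s j \<in> ?H" "lvl j (\<delta> (s j))" "c j (\<delta> (s j)) \<noteq> 0" using s[OF True] by auto
      define k where "k = s j [^] (- z) \<otimes> h'"
      have k: "k \<in> ?H" "lvl j (\<delta> k)" "c j (\<delta> k) = 0"
        unfolding k_def using h' z sj delta_int_pow[OF H sj(1,2), of "- z"] unip_int_pow[OF H]
        by (auto simp: c_delta_mult[OF H] intro!: unipD(4)[OF H] lvl_delta_mult[OF H])
      have "- c j (peel j (\<rho> h) - 1) / c j (\<delta> (s j)) = of_int (- z)"
        using h'(2) z sj(3) by (simp add: \<delta>_def)
      then have "peel (Suc j) (\<rho> h) = \<rho> (s j [^] (- z)) * \<rho> h'"
        unfolding peel_Suc using True h'(2) rho_int_pow[OF H sj(1)] by metis
      also have "\<dots> = \<rho> k"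
        unfolding k_def using sj h' unipD[OF H] by (simp add: rho_mult)
      finally show ?thesis using k by (auto simp: lvl_Suc)
    next
      case False
      then have "c j (\<delta> h') = 0" using h' Suc by (auto simp: jumps_def)
      then show ?thesis using False h' by (auto simp: peel_Suc lvl_Suc)
    qed
  qed
  \<comment> \<open>An element of level i has zero coordinates below i, so the first i exponents are
    0. Peeling therefore leaves the offending element g of \<open>K\<close> untouched.\<close>
  have fixed: "peel j x = x" if "lvl i (x - 1)" "j \<le> i" for i j x
    using that(2)
  proof (induction j)
    case (Suc j)
    then have "c j (x - 1) = 0" using that by (auto simp: lvl_def)
    then show ?case using Suc by (simp add: peel_Suc bin_0)
  qed (simp add: peel_0)
  \<comment> \<open>The induction needs all linear forms at once: expanding \<open>bin\<close> turns
    \<open>l\<close> into the forms y -> l(a^k * y) with a = \<open>\<delta> (s j)\<close>.\<close>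
  have poly: "poly_fun (\<lambda>x. l (peel j x))" if "linear_form l" for l j
    using that
  proof (induction j arbitrary: l)
    case 0
    then show ?case by (simp add: peel_0 poly_fun_linear_form)
  next
    case (Suc j)
    let ?a = "\<delta> (s j)"
    let ?t = "\<lambda>x. - c j (peel j x - 1) / c j ?a"
    have "poly_fun (\<lambda>x. (- 1 / c j ?a) * (c j (peel j x) + (- c j 1)))"
      by (intro poly_fun_mult poly_fun_const poly_fun_add Suc linear_form_c)
    then have t: "poly_fun ?t" by (simp add: c_diff diff_divide_distrib)
    have "poly_fun (\<lambda>x. \<Sum>k\<le>d. (?t x gchoose k) * l (?a ^ k * peel j x))"
      by (intro poly_fun_sum poly_fun_mult poly_fun_gbinomial t Suc linear_form_mult_left) simp
    also have "(\<lambda>x. \<Sum>k\<le>d. (?t x gchoose k) * l (?a ^ k * peel j x)) = (\<lambda>x. l (bin (?t x) ?a * peel j x))"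
      using Suc(2) unfolding bin_def sum_distrib_right
      by (simp add: linear_form_sum[OF Suc(2)] mult.assoc linear_form_def)
    finally show ?case using Suc by (cases "j \<in> jumps ?H") (simp_all add: peel_Suc)
  qed
  fix i assume "i \<in> jumps K"
  then obtain g where g: "g \<in> K" "lvl i (\<delta> g)" "c i (\<delta> g) \<noteq> 0" and i: "i < d" by (auto simp: jumps_def)
  show "i \<in> jumps ?H"
  proof (rule ccontr)
    assume no: "i \<notin> jumps ?H"
    \<comment> \<open>The coordinates belong to x - 1, whence the constant
      \<open>- c i 1\<close>.\<close>
    let ?f = "\<lambda>x. c i (peel i x) + (- c i 1)"
    have "poly_fun ?f" by (intro poly_fun_add poly_fun_const poly linear_form_c)
    moreover have "?f x = 0" if "x \<in> \<rho> ` ?H" for x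
    proof -
      from that obtain h where h: "h \<in> ?H" "x = \<rho> h" by blast
      obtain h' where h': "h' \<in> ?H" "peel i x = \<rho> h'" "lvl i (\<delta> h')" using inH[OF h(1), of i] i h(2) by auto
      then have "c i (\<delta> h') = 0" using no i by (auto simp: jumps_def)
      then show ?thesis using h'(2) by (simp add: \<delta>_def c_diff)
    qed
    ultimately have "?f (\<rho> g) = 0" using zariski_closure_vanish cl g(1) by blast
    moreover have "peel i (\<rho> g) = \<rho> g" using fixed[of i "\<rho> g" i] g(2) by (simp add: \<delta>_def)
    ultimately show False using g(3) by (simp add: \<delta>_def c_diff)
  qed
qed

text \<open>Lower bound for the rank: for a large prime p the p-th powers of elements realising the
  jumps generate a subgroup of 1 + p R for a multiplicatively closed lattice R; there g maps to
  (g - 1) / p modulo p, which is a homomorphism whose image has at least p to the number of jumps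
  elements.\<close>

lemma jumps_le_rank:
  assumes K: "unip K" and rank: "rank_at_most (G\<lparr>carrier := K\<rparr>) q"
  shows "card (jumps K) \<le> q"
proof -
  define I where "I = jumps K"
  have I: "finite I" "\<And>i. i \<in> I \<Longrightarrow> i < d" unfolding I_def by (simp add: finite_jumps, simp add: jumps_def)
  have "\<forall>i\<in>I. \<exists>s. s \<in> K \<and> lvl i (\<delta> s) \<and> c i (\<delta> s) \<noteq> 0" unfolding I_def jumps_def by blast
  then obtain s where s: "\<And>i. i \<in> I \<Longrightarrow> s i \<in> K" "\<And>i. i \<in> I \<Longrightarrow> lvl i (\<delta> (s i))"
    "\<And>i. i \<in> I \<Longrightarrow> c i (\<delta> (s i)) \<noteq> 0" by metis
  \<comment> \<open>The inverses are included because the p-th powers of the inverses must also lie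
    in 1 + p R when the generated subgroup is handled.\<close>
  let ?F = "\<delta> ` (s ` I \<union> (\<lambda>i. inv (s i)) ` I)"
  have "finite ?F" "?F \<subseteq> J" using I s(1) unipD[OF K] by auto
  then obtain R and D :: nat where FR: "?F \<subseteq> R" and R0: "0 \<in> R"
    and R_add: "\<And>a b. a \<in> R \<Longrightarrow> b \<in> R \<Longrightarrow> a + b \<in> R"
    and R_mult: "\<And>a b. a \<in> R \<Longrightarrow> b \<in> R \<Longrightarrow> a * b \<in> R" and RJ: "R \<subseteq> J" and D: "D > 0"
    and DR: "\<And>a i. a \<in> R \<Longrightarrow> i < d \<Longrightarrow> of_nat D * c i a \<in> \<int>"
    by (rule lattice_exists) blast
  have R_of_nat: "of_nat n * a \<in> R" if "a \<in> R" for n a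
    by (induction n) (auto simp: R0 R_add that distrib_right)
  have R_power: "a ^ Suc n \<in> R" if "a \<in> R" for n a
    by (induction n) (use that R_mult in auto)
  have R_sum: "sum f A \<in> R" if "\<And>j. j \<in> A \<Longrightarrow> f j \<in> R" for f :: "nat \<Rightarrow> 'r" and A
    using that by (induction A rule: infinite_finite_induct) (auto simp: R0 R_add)
  define u where "u i = \<lfloor>of_nat D * c i (\<delta> (s i))\<rfloor>" for i
  have u: "of_int (u i) = of_nat D * c i (\<delta> (s i))" if "i \<in> I" for i
  proof -
    have "\<delta> (s i) \<in> R" using FR that by blast
    then show ?thesis using DR[OF _ I(2)[OF that]] by (auto simp: u_def elim: Ints_cases)
  qed
  \<comment> \<open>p > d makes p divide the binomial coefficients that occur in a p-th power, and p
    > |u i| keeps the nonzero integers \<open>u i\<close> invertible modulo p.\<close>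
  obtain p :: nat where p: "Factorial_Ring.prime p" "p > d + (\<Sum>i\<in>I. nat \<bar>u i\<bar>)"
    using bigger_prime by blast
  have p0: "p > 0" using p(1) prime_gt_0_nat by blast
  have u_p: "\<not> int p dvd u i" if "i \<in> I" for i
  proof
    assume "int p dvd u i"
    moreover have "u i \<noteq> 0" using u[OF that] s(3)[OF that] D by auto
    moreover have "nat \<bar>u i\<bar> \<le> (\<Sum>i\<in>I. nat \<bar>u i\<bar>)" using that I by (intro member_le_sum) auto
    ultimately show False using p(2) zdvd_imp_le[of "int p" "\<bar>u i\<bar>"] by auto
  qed
  \<comment> \<open>Dividing p choose (j + 1) by p gives 1 for j = 0, so b is a plus multiples of
    higher powers of a. Those lie deeper, and b keeps the level and the leading coordinate of
    a.\<close>
  have pth_power: "\<exists>b\<in>R. (1 + a) ^ p = 1 + of_nat p * b \<and>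
      (\<forall>i<d. lvl i a \<longrightarrow> lvl i b \<and> c i b = c i a)" if a: "a \<in> R" for a
  proof -
    have aJ: "a \<in> J" using a RJ by blast
    define m where "m j = (p choose Suc j) div p" for j
    define b where "b = (\<Sum>j<d. of_nat (m j) * a ^ Suc j)"
    have pm: "p choose Suc j = p * m j" if "j < d" for j
      unfolding m_def using dvd_choose_prime[of "Suc j" p] p that by simp
    have "(1 + a) ^ p = (\<Sum>j\<le>d. of_nat (p choose j) * a ^ j)"
      unfolding bin_of_nat[OF aJ, symmetric] bin_def
      by (simp add: binomial_gbinomial[symmetric] iota_of_nat)
    also have "\<dots> = 1 + (\<Sum>j<d. of_nat (p choose Suc j) * a ^ Suc j)"
      by (simp only: sum.atMost_shift) simp
    also have "(\<Sum>j<d. of_nat (p choose Suc j) * a ^ Suc j) = of_nat p * b"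
      unfolding b_def sum_distrib_left by (intro sum.cong refl) (simp only: pm lessThan_iff of_nat_mult mult.assoc)
    finally have eq: "(1 + a) ^ p = 1 + of_nat p * b" .
    have bR: "b \<in> R" unfolding b_def by (intro R_sum R_of_nat R_power a)
    have "lvl i b \<and> c i b = c i a" if "i < d" "lvl i a" for i
    proof -
      have m0: "m 0 = 1" unfolding m_def binomial_1 by (rule div_self) (rule not_sym[OF less_imp_neq[OF p0]])
      have cj: "c k (a ^ Suc j) = 0" if j: "j > 0" and ki: "k \<le> i" for j k
      proof -
        obtain j' where j': "j = Suc j'" using gr0_implies_Suc[OF j] ..
        have "lvl (Suc i) (a * a ^ j)"
          unfolding j' by (rule lvl_mult[OF aJ J_power[OF aJ] \<open>lvl i a\<close>])
        then have "lvl (Suc i) (a ^ Suc j)" by (simp only: power_Suc)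
        then show ?thesis using ki unfolding lvl_def by auto
      qed
      have "c k b = c k a" if "k \<le> i" for k
      proof -
        have "c k b = (\<Sum>j<d. of_nat (m j) * c k (a ^ Suc j))" unfolding b_def c_sum c_of_nat ..
        also have "\<dots> = (\<Sum>j\<in>{0}. of_nat (m j) * c k (a ^ Suc j))"
          using \<open>i < d\<close> that by (intro sum.mono_neutral_right) (auto simp: cj simp del: power_Suc)
        finally show ?thesis by (simp add: m0)
      qed
      then show ?thesis using \<open>lvl i a\<close> by (auto simp: lvl_def)
    qed
    then show ?thesis using eq bR by blast
  qed
  define t where "t i = s i [^] p" for i
  let ?P = "generate G (t ` I)"
  have tK: "t ` I \<subseteq> K" using s(1) unip_nat_pow[OF K] by (auto simp: t_def)
  have P: "unip ?P" by (rule unip_generate[OF K tK])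
  have pp: "of_nat p * a * (of_nat p * b) = of_nat p * (of_nat p * (a * b))" for a b :: 'r
    by (metis mult.assoc mult_of_nat_commute)
  have delta_P: "\<exists>a\<in>R. \<delta> g = of_nat p * a" if "g \<in> ?P" for g
    using that
  proof (induction rule: generate.induct)
    case one
    then show ?case using R0 by (auto simp: delta_one intro: bexI[of _ 0])
  next
    case (incl g)
    then obtain i where i: "i \<in> I" "g = s i [^] p" by (auto simp: t_def)
    then obtain b where "b \<in> R" "\<rho> g = 1 + of_nat p * b"
      using pth_power[of "\<delta> (s i)"] FR rho_pow[of "s i" p] unipD(1)[OF K] s(1) by (auto simp: rho_eq[of "s i"])
    then show ?case by (auto simp: \<delta>_def)
  next
    case (inv g)
    then obtain i where i: "i \<in> I" "g = s i [^] p" by (auto simp: t_def)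
    then have "inv g = inv (s i) [^] p" using unipD(1)[OF K] s(1) by (simp add: nat_pow_inv)
    moreover have iR: "\<delta> (inv (s i)) \<in> R" using FR i by blast
    ultimately obtain b where "b \<in> R" "\<rho> (inv g) = 1 + of_nat p * b"
      using pth_power[OF iR] rho_pow[of "inv (s i)" p] unipD(1)[OF K] s(1) i
      by (auto simp: rho_eq[of "inv (s i)"])
    then show ?case by (auto simp: \<delta>_def)
  next
    case (eng g h)
    then obtain a b where ab: "a \<in> R" "b \<in> R" "\<delta> g = of_nat p * a" "\<delta> h = of_nat p * b" by blast
    have "\<delta> (g \<otimes> h) = of_nat p * (a + b + of_nat p * (a * b))"
      unfolding delta_mult[OF unipD(1)[OF P eng(1)] unipD(1)[OF P eng(2)]] ab(3,4) pp distrib_left ..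
    then show ?case using R_add[OF R_add[OF ab(1,2)] R_of_nat[OF R_mult[OF ab(1,2)]]] by (rule bexI)
  qed
  \<comment> \<open>The i-th coordinate of (g - 1) / p, scaled by \<open>D\<close> to an integer;
    the floor is exact on \<open>?P\<close>. Modulo p it is additive, because the mixed term of (1 +
    p a)(1 + p b) carries a second factor p.\<close>
  define v where "v i g = \<lfloor>of_nat D * (c i (\<delta> g) / of_nat p)\<rfloor>" for i g
  have v: "of_int (v i g) = of_nat D * c i a" if "i < d" "a \<in> R" "\<delta> g = of_nat p * a" for i g a
  proof -
    have "c i (\<delta> g) / of_nat p = c i a" using that p0 by (simp add: c_of_nat)
    then show ?thesis using DR[OF that(2,1)] by (auto simp: v_def elim: Ints_cases)
  qed
  have v_mult: "[v i (g \<otimes> h) = v i g + v i h] (mod int p)" if i: "i < d" and gh: "g \<in> ?P" "h \<in> ?P" for i g h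
  proof -
    obtain a b where ab: "a \<in> R" "b \<in> R" "\<delta> g = of_nat p * a" "\<delta> h = of_nat p * b"
      using delta_P gh by blast
    have eq: "\<delta> (g \<otimes> h) = of_nat p * (a + b + of_nat p * (a * b))"
      unfolding delta_mult[OF unipD(1)[OF P gh(1)] unipD(1)[OF P gh(2)]] ab(3,4) pp distrib_left ..
    have "a + b + of_nat p * (a * b) \<in> R"
      using R_add[OF R_add[OF ab(1,2)] R_of_nat[OF R_mult[OF ab(1,2)]]] .
    from v[OF i this eq]
    have "of_int (v i (g \<otimes> h)) = of_nat D * (c i a + c i b) + of_nat p * (of_nat D * c i (a * b))"
      by (simp add: c_add c_of_nat algebra_simps)
    moreover obtain w where "of_nat D * c i (a * b) = of_int w"
      using DR[OF R_mult[OF ab(1,2)] i] by (auto elim: Ints_cases)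
    ultimately have "of_int (v i (g \<otimes> h)) = (of_int (v i g + v i h + int p * w) :: rat)"
      using v[OF i ab(1,3)] v[OF i ab(2,4)] by (simp add: distrib_left)
    then have "v i (g \<otimes> h) = v i g + v i h + int p * w" by (metis of_int_eq_iff)
    then show ?thesis by (simp add: cong_def)
  qed
  have v_one: "v i \<one> = 0" for i by (simp add: v_def delta_one c_zero)
  have v_inv: "[v i (inv g) = - v i g] (mod int p)" if "i < d" "g \<in> ?P" for i g
  proof -
    have "[v i (g \<otimes> inv g) = v i g + v i (inv g)] (mod int p)"
      using v_mult that unipD(5)[OF P] by blast
    then have "[0 = v i g + v i (inv g)] (mod int p)" using that unipD(1)[OF P] by (simp add: v_one)
    then have "[- v i g + 0 = - v i g + (v i g + v i (inv g))] (mod int p)" by (intro cong_add cong_refl)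
    then show ?thesis by (simp add: cong_sym)
  qed
  have v_pow: "[v i (g [^] n) = int n * v i g] (mod int p)" if "i < d" "g \<in> ?P" for i g and n :: nat
  proof (induction n)
    case (Suc n)
    have "[v i (g [^] n \<otimes> g) = v i (g [^] n) + v i g] (mod int p)"
      using v_mult that unip_nat_pow[OF P] by blast
    also have "[v i (g [^] n) + v i g = int n * v i g + v i g] (mod int p)"
      by (intro cong_add Suc cong_refl)
    finally show ?case by (simp add: algebra_simps)
  qed (simp add: v_one)
  \<comment> \<open>The matrix of the values \<open>v i (t k)\<close> is triangular, with the
    diagonal entries \<open>u k\<close> prime to p. The entries with i > k are unknown.\<close>
  have v_t: "v i (t k) = (if i = k then u k else 0)" if k: "k \<in> I" and ik: "i \<le> k" for i k
  proof -
    have "\<delta> (s k) \<in> R" using FR k by blast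
    then obtain b where b: "b \<in> R" "\<rho> (s k) ^ p = 1 + of_nat p * b" "lvl k b" "c k b = c k (\<delta> (s k))"
      using pth_power[of "\<delta> (s k)"] k I s(2) by (auto simp: rho_eq[of "s k"])
    have "\<delta> (t k) = of_nat p * b"
      using b(2) rho_pow[of "s k" p] unipD(1)[OF K s(1)] k by (simp add: t_def \<delta>_def)
    from v[OF _ b(1) this, of i] have "of_int (v i (t k)) = of_nat D * c i b"
      using k ik I by force
    also have "\<dots> = of_int (if i = k then u k else 0)"
      using b k ik u by (auto simp: lvl_def)
    finally show ?thesis by (metis of_int_eq_iff)
  qed
  obtain T where T: "finite T" "card T \<le> q" "T \<subseteq> K" "generate G T = ?P"
  proof -
    have sub: "subgroup K G" using K by (simp add: unip_def)
    obtain T where "finite T" "card T \<le> q" "T \<subseteq> K"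
      "generate (G\<lparr>carrier := K\<rparr>) T = generate (G\<lparr>carrier := K\<rparr>) (t ` I)"
      using rank[unfolded rank_at_most_def, rule_format, of "t ` I"] tK I by auto
    then show ?thesis using that generate_consistent[OF _ sub] tK by metis
  qed
  have TP: "T \<subseteq> ?P" using T(4) generate.incl by fast
  have lower: "\<exists>g\<in>?P. \<forall>i<d. [v i g = (\<Sum>k\<in>A. int (n k) * v i (t k))] (mod int p)"
    if "A \<subseteq> I" for A n
    using finite_subset[OF that I(1)] that
  proof (induction A rule: finite_induct)
    case empty
    then show ?case using generate.one v_one by (intro bexI[of _ "\<one>"]) auto
  next
    case (insert k A)
    then obtain g where g: "g \<in> ?P" "\<forall>i<d. [v i g = (\<Sum>k\<in>A. int (n k) * v i (t k))] (mod int p)" by auto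
    have tk: "t k \<in> ?P" using insert by (intro generate.incl) auto
    have h: "t k [^] n k \<in> ?P" by (rule unip_nat_pow[OF P tk])
    have "[v i (t k [^] n k \<otimes> g) = (\<Sum>k\<in>insert k A. int (n k) * v i (t k))] (mod int p)" if i: "i < d" for i
    proof -
      have "[v i (t k [^] n k \<otimes> g) = v i (t k [^] n k) + v i g] (mod int p)" by (rule v_mult[OF i h g(1)])
      also have "[v i (t k [^] n k) + v i g = int (n k) * v i (t k) + (\<Sum>k\<in>A. int (n k) * v i (t k))] (mod int p)"
        using g i by (intro cong_add v_pow[OF i tk]) auto
      finally show ?thesis using insert by simp
    qed
    moreover have "t k [^] n k \<otimes> g \<in> ?P" using h g(1) by (rule generate.eng)
    ultimately show ?case by blast
  qed
  have upper: "\<exists>m. \<forall>i<d. [v i g = (\<Sum>x\<in>T. m x * v i x)] (mod int p)" if "g \<in> generate G T" for g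
    using that
  proof (induction rule: generate.induct)
    case one
    show ?case by (rule exI[of _ "\<lambda>_. 0"]) (simp add: v_one)
  next
    case (incl g)
    have "(\<Sum>x\<in>T. (if x = g then 1 else 0) * v i x) = v i g" for i
      using incl T(1) by (simp add: if_distrib[of "\<lambda>y. y * _"] cong: if_cong)
    then show ?case by (intro exI[of _ "\<lambda>x. if x = g then 1 else 0"]) simp
  next
    case (inv g)
    have "(\<Sum>x\<in>T. (if x = g then - 1 else 0) * v i x) = - v i g" for i
      using inv T(1) by (simp add: if_distrib[of "\<lambda>y. y * _"] cong: if_cong)
    then show ?case using v_inv inv TP by (intro exI[of _ "\<lambda>x. if x = g then - 1 else 0"]) auto
  next
    case (eng g h)
    then obtain m m' where m: "\<forall>i<d. [v i g = (\<Sum>x\<in>T. m x * v i x)] (mod int p)"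
      "\<forall>i<d. [v i h = (\<Sum>x\<in>T. m' x * v i x)] (mod int p)" by blast
    have "[v i (g \<otimes> h) = (\<Sum>x\<in>T. (m x + m' x) * v i x)] (mod int p)" if i: "i < d" for i
    proof -
      have "[v i (g \<otimes> h) = v i g + v i h] (mod int p)" using v_mult[OF i] eng T(4) by simp
      also have "[v i g + v i h = (\<Sum>x\<in>T. m x * v i x) + (\<Sum>x\<in>T. m' x * v i x)] (mod int p)"
        using m i by (intro cong_add) auto
      finally show ?thesis by (simp add: distrib_right sum.distrib)
    qed
    then show ?case by (intro exI[of _ "\<lambda>x. m x + m' x"] allI impI)
  qed
  have upper': "\<exists>m\<in>T \<rightarrow>\<^sub>E {..<p}. \<forall>i<d. [v i g = (\<Sum>x\<in>T. int (m x) * v i x)] (mod int p)" if "g \<in> ?P" for g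
  proof -
    obtain m where m: "\<forall>i<d. [v i g = (\<Sum>x\<in>T. m x * v i x)] (mod int p)" using upper T(4) \<open>g \<in> ?P\<close> by blast
    let ?m = "restrict (\<lambda>x. nat (m x mod int p)) T"
    have "[(\<Sum>x\<in>T. m x * v i x) = (\<Sum>x\<in>T. int (?m x) * v i x)] (mod int p)" for i
      using p0 by (intro cong_sum cong_mult cong_refl) (auto simp: cong_def)
    then have "\<forall>i<d. [v i g = (\<Sum>x\<in>T. int (?m x) * v i x)] (mod int p)" using m cong_trans by blast
    moreover have "nat (z mod int p) < p" for z using p0 by (simp add: nat_less_iff)
    then have "?m \<in> T \<rightarrow>\<^sub>E {..<p}" by auto
    ultimately show ?thesis by blast
  qed
  \<comment> \<open>Counting replaces linear algebra over the field with p elements: each exponent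
    vector on \<open>I\<close> is assigned a coefficient vector on \<open>T\<close> with the same
    image. Injectivity of this assignment gives p^|I| \<le> p^|T|.\<close>
  have "\<forall>n. \<exists>m\<in>T \<rightarrow>\<^sub>E {..<p}. \<forall>i<d.
      [(\<Sum>k\<in>I. int (n k) * v i (t k)) = (\<Sum>x\<in>T. int (m x) * v i x)] (mod int p)"
  proof
    fix n
    obtain g where g: "g \<in> ?P" "\<forall>i<d. [v i g = (\<Sum>k\<in>I. int (n k) * v i (t k))] (mod int p)"
      using lower[of I n] by blast
    obtain m where "m \<in> T \<rightarrow>\<^sub>E {..<p}" "\<forall>i<d. [v i g = (\<Sum>x\<in>T. int (m x) * v i x)] (mod int p)"
      using upper'[OF g(1)] by blast
    then show "\<exists>m\<in>T \<rightarrow>\<^sub>E {..<p}. \<forall>i<d.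
      [(\<Sum>k\<in>I. int (n k) * v i (t k)) = (\<Sum>x\<in>T. int (m x) * v i x)] (mod int p)"
      using g(2) cong_trans cong_sym by blast
  qed
  from choice[OF this[unfolded Bex_def]] obtain \<Phi> where "\<forall>n. \<Phi> n \<in> T \<rightarrow>\<^sub>E {..<p} \<and> (\<forall>i<d.
      [(\<Sum>k\<in>I. int (n k) * v i (t k)) = (\<Sum>x\<in>T. int (\<Phi> n x) * v i x)] (mod int p))" ..
  then have Phi: "\<And>n. \<Phi> n \<in> T \<rightarrow>\<^sub>E {..<p}"
    "\<And>n i. i < d \<Longrightarrow> [(\<Sum>k\<in>I. int (n k) * v i (t k)) = (\<Sum>x\<in>T. int (\<Phi> n x) * v i x)] (mod int p)"
    by simp_all
  \<comment> \<open>Triangularity: once the entries of n and n' agree below i, the terms with k < i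
    cancel and those with k > i vanish, so the i-th congruence says that p divides (n i - n' i) * u
    i.\<close>
  have "inj_on \<Phi> (I \<rightarrow>\<^sub>E {..<p})"
  proof (rule inj_onI)
    fix n n' assume n: "n \<in> I \<rightarrow>\<^sub>E {..<p}" "n' \<in> I \<rightarrow>\<^sub>E {..<p}" and eq: "\<Phi> n = \<Phi> n'"
    have "n i = n' i" if "i \<in> I" for i
      using that
    proof (induction i rule: less_induct)
      case (less i)
      have "[(\<Sum>k\<in>I. int (n k) * v i (t k)) = (\<Sum>k\<in>I. int (n' k) * v i (t k))] (mod int p)"
        using Phi(2)[OF I(2)[OF less(2)], of n'] unfolding eq[symmetric]
        by (rule cong_trans[OF Phi(2)[OF I(2)[OF less(2)]] cong_sym])
      then have "int p dvd (\<Sum>k\<in>I. int (n k) * v i (t k)) - (\<Sum>k\<in>I. int (n' k) * v i (t k))"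
        by (simp add: cong_iff_dvd_diff)
      also have "\<dots> = (\<Sum>k\<in>I. (int (n k) - int (n' k)) * v i (t k))"
        by (simp add: sum_subtractf left_diff_distrib)
      also have "\<dots> = (\<Sum>k\<in>{i}. (int (n k) - int (n' k)) * v i (t k))"
      proof (rule sum.mono_neutral_right[OF I(1)])
        show "\<forall>k\<in>I - {i}. (int (n k) - int (n' k)) * v i (t k) = 0"
        proof
          fix k assume k: "k \<in> I - {i}"
          then consider "k < i" | "i < k" by fastforce
          then show "(int (n k) - int (n' k)) * v i (t k) = 0"
            using less.IH[of k] v_t[of k i] k by cases auto
        qed
      qed (use less in auto)
      finally have "int p dvd (int (n i) - int (n' i)) * u i" using v_t[OF less(2)] by simp
      then have "int p dvd int (n i) - int (n' i)"
        using u_p[OF less(2)] p(1) prime_dvd_multD[of "int p"] by auto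
      moreover have "n i < p" "n' i < p" using n less(2) by auto
      ultimately show ?case
        using zdvd_imp_le[of "int p" "\<bar>int (n i) - int (n' i)\<bar>"] by fastforce
    qed
    then show "n = n'" using n by (intro PiE_ext) auto
  qed
  moreover have "\<Phi> ` (I \<rightarrow>\<^sub>E {..<p}) \<subseteq> T \<rightarrow>\<^sub>E {..<p}" using Phi(1) by blast
  ultimately have "card (I \<rightarrow>\<^sub>E {..<p}) \<le> card (T \<rightarrow>\<^sub>E {..<p})"
    using T(1) by (intro card_inj_on_le[of \<Phi>]) (auto intro: finite_PiE)
  then have "p ^ card I \<le> p ^ card T" using I T by (simp add: card_PiE)
  then have "card I \<le> card T" using prime_gt_1_nat[OF p(1)] by simp
  then show ?thesis using T(2) by (simp add: I_def)
qed

lemma pruefer_rank_eq: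
  assumes K: "unip K" shows "pruefer_rank (G\<lparr>carrier := K\<rparr>) = enat (card (jumps K))"
  unfolding pruefer_rank_def
proof (rule antisym)
  show "Inf {enat r | r. rank_at_most (G\<lparr>carrier := K\<rparr>) r} \<le> enat (card (jumps K))"
    using rank_at_most_jumps[OF K] by (intro Inf_lower) blast
  show "enat (card (jumps K)) \<le> Inf {enat r | r. rank_at_most (G\<lparr>carrier := K\<rparr>) r}"
    using jumps_le_rank[OF K] by (intro Inf_greatest) auto
qed

section \<open>Closures inside a unipotent group and conjugation\<close>

lemma conjugate_generate:
  assumes w: "w \<in> carrier G" and F: "F \<subseteq> carrier G" and K: "subgroup K G"
    and c: "\<And>y. y \<in> F \<Longrightarrow> w \<otimes> y \<otimes> inv w \<in> K" and h: "h \<in> generate G F"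
  shows "w \<otimes> h \<otimes> inv w \<in> K"
  using h
proof (induction rule: generate.induct)
  case one
  then show ?case using w subgroup.one_closed[OF K] by simp
next
  case (incl h)
  then show ?case by (rule c)
next
  case (inv h)
  then have hc: "h \<in> carrier G" using F by blast
  have "w \<otimes> inv h \<otimes> inv w = inv (w \<otimes> h \<otimes> inv w)"
    using w hc by (simp add: inv_mult_group m_assoc)
  then show ?case using subgroup.m_inv_closed[OF K c[OF inv]] by simp
next
  case (eng h k)
  have hk: "h \<in> carrier G" "k \<in> carrier G" using eng(1,2) generate_in_carrier[OF F] by auto
  have "w \<otimes> (h \<otimes> k) \<otimes> inv w = (w \<otimes> h \<otimes> inv w) \<otimes> (w \<otimes> k \<otimes> inv w)"
    using w hk inv_solve_left[of "k \<otimes> inv w" w] by (simp add: m_assoc)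
  then show ?case using subgroup.m_closed[OF K eng(3,4)] by simp
qed

text \<open>The closure is a set of ring elements. Restricting it to \<open>M\<close> gives group
  elements g with g - 1 in \<open>J\<close>, as the argument for inverses requires.\<close>

definition closure_in :: "'g set \<Rightarrow> 'g set \<Rightarrow> 'g set" where
  "closure_in M H = {g \<in> M. \<rho> g \<in> zariski_closure (\<rho> ` H)}"

lemma subgroup_closure_in:
  assumes M: "unip M" and H: "unip H"
  shows "subgroup (closure_in M H) G"
proof (rule subgroupI)
  note S = rho_image_mult[OF H] rho_image_one[OF H]
  show "closure_in M H \<subseteq> carrier G" using unipD(1)[OF M] by (auto simp: closure_in_def)
  have "\<one> \<in> closure_in M H"
    using unipD(3)[OF M] subsetD[OF zariski_closure_superset S(2)] by (simp add: closure_in_def rho_one)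
  then show "closure_in M H \<noteq> {}" by blast
  fix a assume a: "a \<in> closure_in M H"
  then have aM: "a \<in> M" and ac: "a \<in> carrier G" using unipD(1)[OF M] by (auto simp: closure_in_def)
  have "\<rho> (inv a) * \<rho> a = 1" using rho_mult[of "inv a" a] ac by (simp add: rho_one)
  then have "\<rho> (inv a) \<in> zariski_closure (\<rho> ` H)"
    using zariski_closure_inverse[OF S] a unipD(2)[OF M aM] by (simp add: closure_in_def \<delta>_def)
  then show "inv a \<in> closure_in M H" using unipD(5)[OF M aM] by (simp add: closure_in_def)
  fix b assume b: "b \<in> closure_in M H"
  then have bM: "b \<in> M" and bc: "b \<in> carrier G" using unipD(1)[OF M] by (auto simp: closure_in_def)
  have "\<rho> a * \<rho> b \<in> zariski_closure (\<rho> ` H)"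
    using a b by (intro zariski_closure_mult[OF S(1)]) (auto simp: closure_in_def)
  then show "a \<otimes> b \<in> closure_in M H"
    using unipD(4)[OF M aM bM] ac bc by (simp add: closure_in_def rho_mult)
qed

text \<open>In the application F generates \<open>H t\<close> and K is \<open>H (Suc t)\<close>:
  conjugating generators lands in a larger group, but one inside the same closure.\<close>

lemma closure_in_conjugate:
  assumes M: "unip M" and w: "w \<in> carrier G" and F: "F \<subseteq> M"
    and K: "subgroup K G" "\<rho> ` K \<subseteq> zariski_closure (\<rho> ` generate G F)"
    and c: "\<And>y. y \<in> F \<Longrightarrow> w \<otimes> y \<otimes> inv w \<in> K"
    and norm: "\<And>g. g \<in> M \<Longrightarrow> w \<otimes> g \<otimes> inv w \<in> M"
    and g: "g \<in> closure_in M (generate G F)"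
  shows "w \<otimes> g \<otimes> inv w \<in> closure_in M (generate G F)"
proof -
  have FG: "F \<subseteq> carrier G" using F unipD(1)[OF M] by auto
  have conj: "\<rho> (w \<otimes> k \<otimes> inv w) = \<rho> w * \<rho> k * \<rho> (inv w)" if "k \<in> carrier G" for k
    using w that by (simp add: rho_mult)
  have gM: "g \<in> M" and gZ: "\<rho> g \<in> zariski_closure (\<rho> ` generate G F)"
    using g by (auto simp: closure_in_def)
  have "\<rho> w * x * \<rho> (inv w) \<in> zariski_closure (\<rho> ` generate G F)" if x: "x \<in> \<rho> ` generate G F" for x
  proof -
    obtain h where h: "h \<in> generate G F" "x = \<rho> h" using x by blast
    have "w \<otimes> h \<otimes> inv w \<in> K" using conjugate_generate[OF w FG K(1) c h(1)] .
    then show ?thesis using K(2) conj[OF generate_in_carrier[OF FG h(1)]] h(2) by auto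
  qed
  from zariski_closure_conjugate[OF this gZ]
  show ?thesis using norm[OF gM] conj[OF unipD(1)[OF M gM]] by (simp add: closure_in_def)
qed

text \<open>Conjugation by w and by its inverse are separate assumptions, because an infinite group
  may be conjugated properly into itself. This is the role of both kinds of conjugates in the
  construction of \<open>H\<close>.\<close>

lemma normalised_generate:
  assumes S: "S \<subseteq> carrier G" and C: "C \<subseteq> carrier G"
    and c: "\<And>w g. w \<in> S \<Longrightarrow> g \<in> C \<Longrightarrow> w \<otimes> g \<otimes> inv w \<in> C"
    and c': "\<And>w g. w \<in> S \<Longrightarrow> g \<in> C \<Longrightarrow> inv w \<otimes> g \<otimes> inv (inv w) \<in> C"
    and w: "w \<in> generate G S" and g: "g \<in> C"
  shows "w \<otimes> g \<otimes> inv w \<in> C"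
  using w g
proof (induction arbitrary: g rule: generate.induct)
  case one
  then show ?case using C by auto
next
  case (eng v w)
  have vw: "v \<in> carrier G" "w \<in> carrier G" using eng(1,2) generate_in_carrier[OF S] by auto
  have "v \<otimes> w \<otimes> g \<otimes> inv (v \<otimes> w) = v \<otimes> (w \<otimes> g \<otimes> inv w) \<otimes> inv v"
    using vw eng(5) C by (auto simp: inv_mult_group m_assoc)
  then show ?case using eng by simp
qed (use c c' in auto)

end

section \<open>Fixed vectors of unipotent groups\<close>

context group
begin

text \<open>Pigeonhole on the cosets of the powers of u.\<close>

lemma finite_rcosets_power:
  assumes S: "subgroup S G" and fin: "finite (rcosets S)" and u: "u \<in> carrier G"
  shows "\<exists>m::nat. m > 0 \<and> u [^] m \<in> S"
proof -
  have "range (\<lambda>n::nat. S #> u [^] n) \<subseteq> rcosets S"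
    using u by (auto simp: RCOSETS_def)
  then have "finite (range (\<lambda>n::nat. S #> u [^] n))" using fin finite_subset by blast
  then have "\<not> inj (\<lambda>n::nat. S #> u [^] n)" using finite_imageD infinite_UNIV_nat by blast
  then obtain m n :: nat where mn: "m < n" "S #> u [^] m = S #> u [^] n"
    unfolding inj_def by (metis linorder_neqE_nat)
  have "u [^] n \<in> S #> u [^] m" using rcos_self[OF _ S, of "u [^] n"] u mn by simp
  then obtain h where h: "h \<in> S" "u [^] n = h \<otimes> u [^] m" unfolding r_coset_def by blast
  have hc: "h \<in> carrier G" using subgroup.mem_carrier[OF S h(1)] .
  have "u [^] (n - m) \<otimes> u [^] m = h \<otimes> u [^] m"
    using mn(1) h(2) u by (simp add: nat_pow_mult)
  then have "u [^] (n - m) = h" using u hc by simp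
  then show ?thesis using h(1) mn(1) by (intro exI[of _ "n - m"]) auto
qed

end

lemma mult_GL [simp]: "g \<otimes>\<^bsub>GL\<^esub> h = g ** h"
  by (simp add: GL_def)

lemma one_GL [simp]: "\<one>\<^bsub>GL\<^esub> = mat 1"
  by (simp add: GL_def)

interpretation GL: group GL
  by (rule group_GL)

lemma GL_inv:
  assumes "g \<in> carrier GL"
  shows "inv\<^bsub>GL\<^esub> g ** g = mat 1" "g ** inv\<^bsub>GL\<^esub> g = mat 1"
  using GL.l_inv[OF assms] GL.r_inv[OF assms] by simp_all

lemma GL_inv_vec:
  assumes "g \<in> carrier GL"
  shows "inv\<^bsub>GL\<^esub> g *v (g *v v) = v" "g *v (inv\<^bsub>GL\<^esub> g *v v) = v"
  using GL_inv[OF assms] by (simp_all add: matrix_vector_mul_assoc)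

section \<open>Chief factors of the natural module\<close>

definition invariant :: "('a::field ^ 'n ^ 'n) set \<Rightarrow> ('a ^ 'n) set \<Rightarrow> bool" where
  "invariant K B \<longleftrightarrow> vec.subspace B \<and> (\<forall>g\<in>K. \<forall>v\<in>B. g *v v \<in> B)"

text \<open>B/A is an irreducible module for K. No quotient spaces are formed: an element h acts
  trivially on B/A when h v - v lies in A for all v in B.\<close>

definition chief :: "('a::field ^ 'n ^ 'n) set \<Rightarrow> ('a ^ 'n) set \<Rightarrow> ('a ^ 'n) set \<Rightarrow> bool" where
  "chief K A B \<longleftrightarrow> invariant K A \<and> invariant K B \<and> A \<subset> B \<and>
     (\<forall>C. invariant K C \<longrightarrow> A \<subseteq> C \<longrightarrow> C \<subseteq> B \<longrightarrow> C = A \<or> C = B)"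

lemma invariant_subspace: "invariant K B \<Longrightarrow> vec.subspace B"
  by (simp add: invariant_def)

lemma invariantD: "invariant K B \<Longrightarrow> g \<in> K \<Longrightarrow> v \<in> B \<Longrightarrow> g *v v \<in> B"
  by (simp add: invariant_def)

lemma invariant_0: "invariant K {0}"
  by (simp add: invariant_def vec.subspace_0 vec.subspace_def)

lemma invariant_UNIV: "invariant K UNIV"
  by (simp add: invariant_def)

lemma invariant_mono: "invariant K B \<Longrightarrow> L \<subseteq> K \<Longrightarrow> invariant L B"
  by (auto simp: invariant_def)

lemma dim_invariant_less:
  assumes "invariant K A" "invariant K B" "A \<subset> B"
  shows "vec.dim A < vec.dim B"
  using assms vec.subspace_dim_equal[of A B] unfolding invariant_def
  by (metis not_le psubset_eq)

lemma chief_above: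
  assumes "invariant K A" "invariant K B" "A \<subset> B"
  obtains B' where "chief K A B'" "B' \<subseteq> B"
proof -
  define P where "P C \<longleftrightarrow> invariant K C \<and> A \<subset> C \<and> C \<subseteq> B" for C
  have "P B" using assms by (auto simp: P_def)
  then obtain C where C: "P C" and min: "\<And>C'. P C' \<Longrightarrow> vec.dim C \<le> vec.dim C'"
    using ex_has_least_nat[of P B vec.dim] by blast
  have "chief K A C"
    unfolding chief_def
  proof (intro conjI allI impI)
    fix D assume D: "invariant K D" "A \<subseteq> D" "D \<subseteq> C"
    show "D = A \<or> D = C"
    proof (rule ccontr)
      assume "\<not> (D = A \<or> D = C)"
      then have "P D" "D \<subset> C" using C D by (auto simp: P_def)
      then show False using min[of D] dim_invariant_less[of K D C] C D by (auto simp: P_def)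
    qed
  qed (use C assms in \<open>auto simp: P_def\<close>)
  then show ?thesis using C that by (auto simp: P_def)
qed

text \<open>The conclusion of Kolchin's theorem, demanded of every nonzero section B/A and not just
  of the whole space, because it is applied to chief factors of larger groups.\<close>

definition has_fixed_vectors :: "('a::field ^ 'n ^ 'n) set \<Rightarrow> bool" where
  "has_fixed_vectors K \<longleftrightarrow> (\<forall>A B. invariant K A \<longrightarrow> invariant K B \<longrightarrow> A \<subset> B \<longrightarrow>
     (\<exists>v\<in>B - A. \<forall>g\<in>K. g *v v - v \<in> A))"

lemma subspace_fixed:
  assumes "vec.subspace A" "vec.subspace B"
  shows "vec.subspace {v \<in> B. \<forall>h\<in>L. h *v v - v \<in> A}"
proof (rule vec.subspaceI)
  fix v w assume "v \<in> {v \<in> B. \<forall>h\<in>L. h *v v - v \<in> A}" "w \<in> {v \<in> B. \<forall>h\<in>L. h *v v - v \<in> A}"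
  then have vw: "v + w \<in> B" and *: "\<And>h. h \<in> L \<Longrightarrow> (h *v v - v) + (h *v w - w) \<in> A"
    using vec.subspace_add[OF assms(1)] vec.subspace_add[OF assms(2)] by auto
  have "h *v (v + w) - (v + w) \<in> A" if "h \<in> L" for h
    using *[OF that] by (simp only: matrix_vector_right_distrib add_diff_add)
  then show "v + w \<in> {v \<in> B. \<forall>h\<in>L. h *v v - v \<in> A}" using vw by blast
next
  fix k v assume v: "v \<in> {v \<in> B. \<forall>h\<in>L. h *v v - v \<in> A}"
  have "h *v (k *s v) - k *s v \<in> A" if "h \<in> L" for h
    unfolding vector_scalar_commute vec.scale_right_diff_distrib[symmetric]
    using v that by (intro vec.subspace_scale[OF assms(1)]) blast
  then show "k *s v \<in> {v \<in> B. \<forall>h\<in>L. h *v v - v \<in> A}"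
    using v vec.subspace_scale[OF assms(2)] by blast
qed (use assms vec.subspace_0 in auto)

text \<open>Clifford's argument: the fixed vectors of a normalised subset form an invariant subspace.\<close>

lemma chief_fixed:
  assumes K: "K \<subseteq> carrier GL" and ch: "chief K A B" and L: "L \<subseteq> K" "has_fixed_vectors L"
    and norm: "\<And>g h. g \<in> K \<Longrightarrow> h \<in> L \<Longrightarrow> inv\<^bsub>GL\<^esub> g ** h ** g \<in> L"
    and v: "v \<in> B" and h: "h \<in> L"
  shows "h *v v - v \<in> A"
proof -
  have A: "invariant K A" and B: "invariant K B" and AB: "A \<subset> B"
    and max: "\<And>C. invariant K C \<Longrightarrow> A \<subseteq> C \<Longrightarrow> C \<subseteq> B \<Longrightarrow> C = A \<or> C = B"
    using ch by (auto simp: chief_def)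
  note subA = invariant_subspace[OF A]
  define C where "C = {v \<in> B. \<forall>h\<in>L. h *v v - v \<in> A}"
  have "invariant K C"
    unfolding invariant_def
  proof (intro conjI ballI)
    show "vec.subspace C" unfolding C_def by (rule subspace_fixed[OF subA invariant_subspace[OF B]])
    fix g w assume g: "g \<in> K" and w: "w \<in> C"
    have gc: "g \<in> carrier GL" using g K by blast
    have "k *v (g *v w) - g *v w \<in> A" if k: "k \<in> L" for k
    proof -
      have "g *v ((inv\<^bsub>GL\<^esub> g ** k ** g) *v w - w) = k *v (g *v w) - g *v w"
        using GL_inv[OF gc] by (simp add: matrix_vector_mult_diff_distrib matrix_vector_mul_assoc matrix_mul_assoc)
      moreover have "(inv\<^bsub>GL\<^esub> g ** k ** g) *v w - w \<in> A" using w norm[OF g k] by (simp add: C_def)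
      ultimately show ?thesis using invariantD[OF A g] by metis
    qed
    then show "g *v w \<in> C" using w invariantD[OF B g] by (simp add: C_def)
  qed
  moreover have "A \<subseteq> C"
    using AB A L(1) vec.subspace_diff[OF subA] by (auto simp: C_def invariant_def)
  moreover have "C \<subseteq> B" by (auto simp: C_def)
  moreover obtain w where "w \<in> B - A" "\<forall>g\<in>L. g *v w - w \<in> A"
    using L(2) invariant_mono[OF A L(1)] invariant_mono[OF B L(1)] AB
    unfolding has_fixed_vectors_def by blast
  then have "C \<noteq> A" by (auto simp: C_def)
  ultimately have "C = B" using max by blast
  then show ?thesis using v h by (auto simp: C_def)
qed

lemma unipotent_iterate:
  fixes g :: "'a::field ^ 'n ^ 'n"
  shows "(((**) (g - mat 1)) ^^ k) (mat 1) *v w = ((\<lambda>v. g *v v - v) ^^ k) w"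
  by (induction k) (simp_all add: matrix_vector_mul_assoc[symmetric] matrix_vector_mult_diff_rdistrib)

lemma iterate_exit:
  fixes f :: "'b \<Rightarrow> 'b"
  assumes "(f ^^ k) w \<in> A" "w \<notin> A"
  obtains j where "(f ^^ j) w \<notin> A" "f ((f ^^ j) w) \<in> A"
proof -
  define j where "j = (LEAST j. (f ^^ j) w \<in> A)"
  have j: "(f ^^ j) w \<in> A" unfolding j_def using assms(1) by (rule LeastI)
  then have "j \<noteq> 0" using assms(2) by (metis funpow_0)
  then obtain i where i: "j = Suc i" using not0_implies_Suc by blast
  then have "(f ^^ i) w \<notin> A" using not_less_Least[of i "\<lambda>j. (f ^^ j) w \<in> A"] unfolding j_def by simp
  then show ?thesis using that[of i] j i by simp
qed

text \<open>The last iterate of w under g - 1 that is still outside A.\<close>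

lemma unipotent_fixed_vector:
  fixes g :: "'a::field ^ 'n ^ 'n"
  assumes g: "unipotent_matrix g" and A: "vec.subspace A" and B: "vec.subspace B"
    and gB: "\<And>v. v \<in> B \<Longrightarrow> g *v v \<in> B" and w: "w \<in> B" "w \<notin> A"
  obtains v where "v \<in> B" "v \<notin> A" "g *v v - v \<in> A"
proof -
  let ?f = "\<lambda>v. g *v v - v"
  obtain k where "(((**) (g - mat 1)) ^^ k) (mat 1) = 0" using g by (auto simp: unipotent_matrix_def)
  then have "(?f ^^ k) w \<in> A" using unipotent_iterate[of k g w] vec.subspace_0[OF A] by simp
  then obtain j where j: "(?f ^^ j) w \<notin> A" "?f ((?f ^^ j) w) \<in> A" using iterate_exit[of k ?f w A] w by blast
  have "(?f ^^ j) w \<in> B" by (induction j) (use w gB B vec.subspace_diff in auto)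
  then show ?thesis using that j by blast
qed

text \<open>One step up the derived series. By Clifford's argument L, which contains the
  commutators, is trivial on every chief factor of K, so K acts there by commuting maps. The fixed
  vectors of a single g then form an invariant subspace, nonzero since g is unipotent, hence
  everything.\<close>

lemma has_fixed_vectors_commutator:
  assumes K: "subgroup K GL" "\<And>g. g \<in> K \<Longrightarrow> unipotent_matrix g"
    and L: "L \<subseteq> K" "has_fixed_vectors L"
    and Lm: "\<And>g h. g \<in> L \<Longrightarrow> h \<in> L \<Longrightarrow> g ** h \<in> L"
    and com: "\<And>g h. g \<in> K \<Longrightarrow> h \<in> K \<Longrightarrow> g ** h ** inv\<^bsub>GL\<^esub> g ** inv\<^bsub>GL\<^esub> h \<in> L"
  shows "has_fixed_vectors K"
  unfolding has_fixed_vectors_def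
proof (intro allI impI)
  fix A B assume A: "invariant K A" and "invariant K B" "A \<subset> B"
  then obtain B' where ch: "chief K A B'" and B': "B' \<subseteq> B" using chief_above by blast
  have KG: "K \<subseteq> carrier GL" using K(1) subgroup.subset by blast
  have invB: "invariant K B'" and AB': "A \<subset> B'"
    and max: "\<And>C. invariant K C \<Longrightarrow> A \<subseteq> C \<Longrightarrow> C \<subseteq> B' \<Longrightarrow> C = A \<or> C = B'"
    using ch by (auto simp: chief_def)
  note subA = invariant_subspace[OF A]
  have inv: "inv\<^bsub>GL\<^esub> g \<in> K" if "g \<in> K" for g using that K(1) by (simp add: subgroup.m_inv_closed)
  have norm: "inv\<^bsub>GL\<^esub> g ** h ** g \<in> L" if g: "g \<in> K" and h: "h \<in> L" for g h
  proof -
    have hK: "h \<in> K" and c: "g \<in> carrier GL" "h \<in> carrier GL" using g h L(1) KG by auto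
    have "(inv\<^bsub>GL\<^esub> g ** h ** inv\<^bsub>GL\<^esub> (inv\<^bsub>GL\<^esub> g) ** inv\<^bsub>GL\<^esub> h) ** h = inv\<^bsub>GL\<^esub> g ** h ** g"
      using GL_inv[OF c(2)] c by (simp add: matrix_mul_assoc[symmetric])
    then show ?thesis using Lm[OF com[OF inv[OF g] hK] h] by simp
  qed
  have triv: "h *v v - v \<in> A" if "h \<in> L" "v \<in> B'" for h v
    using chief_fixed[OF KG ch L norm that(2,1)] .
  have "g *v v - v \<in> A" if g: "g \<in> K" and v: "v \<in> B'" for g v
  proof -
    define C where "C = {v \<in> B'. \<forall>h\<in>{g}. h *v v - v \<in> A}"
    have gc: "g \<in> carrier GL" using g KG by blast
    have "invariant K C"
      unfolding invariant_def
    proof (intro conjI ballI)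
      show "vec.subspace C" unfolding C_def by (rule subspace_fixed[OF subA invariant_subspace[OF invB]])
      fix h w assume h: "h \<in> K" and w: "w \<in> C"
      have hc: "h \<in> carrier GL" using h KG by blast
      \<comment> \<open>The commutator for which h g k = g h. It lies in L, so k moves w only within
        A.\<close>
      define k where "k = inv\<^bsub>GL\<^esub> g ** inv\<^bsub>GL\<^esub> h ** inv\<^bsub>GL\<^esub> (inv\<^bsub>GL\<^esub> g) ** inv\<^bsub>GL\<^esub> (inv\<^bsub>GL\<^esub> h)"
      have "g ** k = inv\<^bsub>GL\<^esub> h ** g ** h"
        using GL_inv[OF gc] gc hc by (simp add: k_def matrix_mul_assoc)
      then have hgk: "h ** (g ** k) = g ** h" using GL_inv[OF hc] by (simp add: matrix_mul_assoc)
      have wB: "w \<in> B'" and gw: "g *v w - w \<in> A" using w by (auto simp: C_def)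
      have kw: "k *v w - w \<in> A" using triv[OF com[OF inv[OF g] inv[OF h]] wB] by (simp add: k_def)
      have "g *v (h *v w) - h *v w = h *v (g *v (k *v w - w) + (g *v w - w))"
        using hgk by (simp add: matrix_vector_mult_diff_distrib matrix_vector_right_distrib matrix_vector_mul_assoc)
      moreover have "g *v (k *v w - w) + (g *v w - w) \<in> A"
        using invariantD[OF A g kw] gw vec.subspace_add[OF subA] by blast
      ultimately have "g *v (h *v w) - h *v w \<in> A" using invariantD[OF A h] by metis
      then show "h *v w \<in> C" using wB invariantD[OF invB h] by (simp add: C_def)
    qed
    moreover have "A \<subseteq> C"
      using AB' A g vec.subspace_diff[OF subA] by (auto simp: C_def invariant_def)
    moreover have "C \<subseteq> B'" by (auto simp: C_def)
    moreover obtain w where w: "w \<in> B'" "w \<notin> A" using AB' by blast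
    obtain u where "u \<in> B'" "u \<notin> A" "g *v u - u \<in> A"
      using unipotent_fixed_vector[OF K(2)[OF g] subA invariant_subspace[OF invB] invariantD[OF invB g] w]
      by blast
    then have "C \<noteq> A" by (auto simp: C_def)
    ultimately have "C = B'" using max by blast
    then show ?thesis using v by (auto simp: C_def)
  qed
  moreover obtain w where "w \<in> B' - A" using AB' by blast
  ultimately show "\<exists>v\<in>B - A. \<forall>g\<in>K. g *v v - v \<in> A" using B' by blast
qed

text \<open>In characteristic 0 a unipotent element of finite order is trivial.\<close>

lemma has_fixed_vectors_finite_index:
  fixes K :: "('a::field_char_0 ^ 'n ^ 'n) set"
  assumes K: "subgroup K GL" "\<And>g. g \<in> K \<Longrightarrow> unipotent_matrix g"
    and L: "L \<subseteq> K" "has_fixed_vectors L"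
    and norm: "\<And>g h. g \<in> K \<Longrightarrow> h \<in> L \<Longrightarrow> inv\<^bsub>GL\<^esub> g ** h ** g \<in> L"
    and pow: "\<And>g. g \<in> K \<Longrightarrow> \<exists>m::nat. m > 0 \<and> g [^]\<^bsub>GL\<^esub> m \<in> L"
  shows "has_fixed_vectors K"
  unfolding has_fixed_vectors_def
proof (intro allI impI)
  fix A B assume A: "invariant K A" and "invariant K B" "A \<subset> B"
  then obtain B' where ch: "chief K A B'" and B': "B' \<subseteq> B" using chief_above by blast
  have KG: "K \<subseteq> carrier GL" using K(1) subgroup.subset by blast
  have invB: "invariant K B'" and AB': "A \<subset> B'" using ch by (auto simp: chief_def)
  note subA = invariant_subspace[OF A]
  have "g *v v - v \<in> A" if g: "g \<in> K" and v: "v \<in> B'" for g v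
  proof (rule ccontr)
    assume nA: "g *v v - v \<notin> A"
    define f where "f v = g *v v - v" for v
    have feq: "f = (\<lambda>v. g *v v - v)" by (simp add: f_def fun_eq_iff)
    have fB: "f w \<in> B'" if "w \<in> B'" for w
      using that invariantD[OF invB g] vec.subspace_diff[OF invariant_subspace[OF invB]] by (simp add: f_def)
    obtain k where "(((**) (g - mat 1)) ^^ k) (mat 1) = 0" using K(2)[OF g] by (auto simp: unipotent_matrix_def)
    then have "(f ^^ k) (f v) \<in> A" using unipotent_iterate[of k g "f v"] vec.subspace_0[OF subA] by (simp add: feq)
    then obtain j where j: "(f ^^ j) (f v) \<notin> A" "f ((f ^^ j) (f v)) \<in> A"
      using iterate_exit[of k f "f v" A] nA f_def by metis
    \<comment> \<open>The vector w satisfies (g - 1)^2 w \<in> A but not (g - 1) w \<in> A. Modulo A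
      the powers of g act on it by g^n w = w + n (g - 1) w, and a power in L forces n (g - 1) w into
      A.\<close>
    define w where "w = (f ^^ j) v"
    have fw: "(f ^^ j) (f v) = f w" by (simp add: w_def funpow_swap1)
    have wB: "w \<in> B'" unfolding w_def by (induction j) (use v fB in auto)
    have ffw: "f (f w) \<in> A" "f w \<notin> A" using j fw by auto
    have "(g [^]\<^bsub>GL\<^esub> n) *v w - w - of_nat n *s f w \<in> A" for n :: nat
    proof (induction n)
      case 0
      then show ?case using vec.subspace_0[OF subA] by simp
    next
      case (Suc n)
      have "g *v ((g [^]\<^bsub>GL\<^esub> n) *v w - w - of_nat n *s f w) + of_nat n *s f (f w) \<in> A"
        using invariantD[OF A g Suc] vec.subspace_add[OF subA] vec.subspace_scale[OF subA ffw(1)] by blast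
      also have "g *v ((g [^]\<^bsub>GL\<^esub> n) *v w - w - of_nat n *s f w) + of_nat n *s f (f w)
          = (g [^]\<^bsub>GL\<^esub> Suc n) *v w - w - of_nat (Suc n) *s f w"
      proof -
        have gc: "g \<in> carrier GL" using g KG by blast
        have "g [^]\<^bsub>GL\<^esub> Suc n = g ** g [^]\<^bsub>GL\<^esub> n" using GL.nat_pow_Suc2[OF gc, of n] by simp
        then have "(g [^]\<^bsub>GL\<^esub> Suc n) *v w = g *v ((g [^]\<^bsub>GL\<^esub> n) *v w)" by (simp add: matrix_vector_mul_assoc)
        moreover have "g *v (of_nat n *s f w) = of_nat n *s (g *v f w)" by (simp add: vector_scalar_commute)
        moreover have "g *v w = f w + w" "g *v f w = f (f w) + f w" by (simp_all add: f_def)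
        ultimately show ?thesis
          by (simp add: matrix_vector_mult_diff_distrib vec.scale_left_distrib vec.scale_right_distrib)
      qed
      finally show ?case .
    qed
    moreover obtain m :: nat where m: "m > 0" "g [^]\<^bsub>GL\<^esub> m \<in> L" using pow[OF g] by blast
    moreover have "(g [^]\<^bsub>GL\<^esub> m) *v w - w \<in> A" using chief_fixed[OF KG ch L norm wB m(2)] .
    ultimately have "((g [^]\<^bsub>GL\<^esub> m) *v w - w) - ((g [^]\<^bsub>GL\<^esub> m) *v w - w - of_nat m *s f w) \<in> A"
      using vec.subspace_diff[OF subA] by blast
    then have "of_nat m *s f w \<in> A" by simp
    then have "(1 / of_nat m) *s (of_nat m *s f w) \<in> A" by (rule vec.subspace_scale[OF subA])
    then show False using m(1) ffw(2) by simp
  qed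
  moreover obtain w where "w \<in> B' - A" using AB' by blast
  ultimately show "\<exists>v\<in>B - A. \<forall>g\<in>K. g *v v - v \<in> A" using B' by blast
qed

text \<open>Induction along the intersections of U with the derived series of the solvable normal
  subgroup S, starting at the trivial group; then one step from \<open>U \<inter> S\<close> to U, as
  every element of U has a positive power in S.\<close>

lemma solvable_by_finite_unipotent_fixed:
  fixes G :: "('a::field_char_0 ^ 'n ^ 'n) set"
  assumes G: "subgroup G GL" and sf: "solvable_by_finite (GL\<lparr>carrier := G\<rparr>)"
    and U: "subgroup U GL" "U \<subseteq> G" "\<And>u. u \<in> U \<Longrightarrow> unipotent_matrix u"
  shows "has_fixed_vectors U"
proof -
  let ?G = "GL\<lparr>carrier := G\<rparr>"
  interpret G: group ?G by (rule GL.subgroup_imp_group[OF G])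
  obtain S where S: "S \<lhd> ?G" "solvable (?G\<lparr>carrier := S\<rparr>)" "finite (rcosets\<^bsub>?G\<^esub> S)"
    using sf by (auto simp: solvable_by_finite_def)
  have invG: "inv\<^bsub>?G\<^esub> g = inv\<^bsub>GL\<^esub> g" if "g \<in> G" for g using GL.m_inv_consistent[OF G that] by simp
  have subS: "subgroup S ?G" using S(1) normal_imp_subgroup by blast
  have SGL: "subgroup S GL" using GL.incl_subgroup[OF G subS] .
  let ?S = "GL\<lparr>carrier := S\<rparr>"
  interpret S: group ?S by (rule GL.subgroup_imp_group[OF SGL])
  have "solvable ?S" using S(2) by simp
  then obtain n where n: "(derived ?S ^^ n) S = {mat 1}"
    using S.solvable_iff_trivial_derived_seq by auto
  define D where "D k = (derived ?S ^^ k) S" for k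
  have D: "subgroup (D k) ?S" for k
    unfolding D_def using S.exp_of_derived_is_subgroup[OF S.subgroup_self, of k] by simp
  have DGL: "subgroup (D k) GL" for k by (rule GL.incl_subgroup[OF SGL D])
  have DS: "D k \<subseteq> S" for k using subgroup.subset[OF D] by simp
  have comm: "g ** h ** inv\<^bsub>GL\<^esub> g ** inv\<^bsub>GL\<^esub> h \<in> D (Suc k)" if "g \<in> D k" "h \<in> D k" for g h k
  proof -
    have gh: "g \<in> S" "h \<in> S" using that DS by auto
    have "g \<otimes>\<^bsub>?S\<^esub> h \<otimes>\<^bsub>?S\<^esub> inv\<^bsub>?S\<^esub> g \<otimes>\<^bsub>?S\<^esub> inv\<^bsub>?S\<^esub> h \<in> derived ?S (D k)"
      unfolding derived_def using that by (intro generate.incl) blast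
    then show ?thesis using GL.m_inv_consistent[OF SGL gh(1)] GL.m_inv_consistent[OF SGL gh(2)]
      by (simp add: D_def)
  qed
  have Dsub: "D (Suc k) \<subseteq> D k" for k
    using S.derived_incl[OF subset_refl D, of k] by (simp add: D_def)
  have UD: "subgroup (U \<inter> D k) GL" for k using U(1) DGL GL.subgroups_Inter_pair by blast
  have "has_fixed_vectors (U \<inter> D k)" if "k \<le> n" for k
    using that
  proof (induction k rule: inc_induct)
    case base
    have "U \<inter> D n \<subseteq> {mat 1}" using n by (auto simp: D_def)
    have "\<exists>v\<in>B - A. \<forall>g\<in>U \<inter> D n. g *v v - v \<in> A"
      if "invariant (U \<inter> D n) A" and AB: "A \<subset> B" for A B
    proof -
      have "0 \<in> A" using that(1) vec.subspace_0 by (auto simp: invariant_def)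
      moreover obtain v where "v \<in> B - A" using AB by blast
      ultimately show ?thesis using \<open>U \<inter> D n \<subseteq> {mat 1}\<close> by (intro bexI[of _ v]) auto
    qed
    then show ?case unfolding has_fixed_vectors_def by blast
  next
    case (step k)
    show ?case
    proof (rule has_fixed_vectors_commutator[OF UD _ _ step.IH])
      show "unipotent_matrix g" if "g \<in> U \<inter> D k" for g using that U(3) by blast
      show "U \<inter> D (Suc k) \<subseteq> U \<inter> D k" using Dsub by blast
      show "g ** h \<in> U \<inter> D (Suc k)" if "g \<in> U \<inter> D (Suc k)" "h \<in> U \<inter> D (Suc k)" for g h
        using subgroup.m_closed[OF UD that] by simp
      show "g ** h ** inv\<^bsub>GL\<^esub> g ** inv\<^bsub>GL\<^esub> h \<in> U \<inter> D (Suc k)" if gh: "g \<in> U \<inter> D k" "h \<in> U \<inter> D k" for g h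
      proof -
        have "g ** h ** inv\<^bsub>GL\<^esub> g ** inv\<^bsub>GL\<^esub> h \<in> U"
          using gh subgroup.m_closed[OF U(1)] subgroup.m_inv_closed[OF U(1)] by (metis IntD1 mult_GL)
        then show ?thesis using comm gh by blast
      qed
    qed
  qed
  from this[of 0] have US: "has_fixed_vectors (U \<inter> S)" by (simp add: D_def)
  show ?thesis
  proof (rule has_fixed_vectors_finite_index[OF U(1,3) _ US])
    show "inv\<^bsub>GL\<^esub> g ** h ** g \<in> U \<inter> S" if gh: "g \<in> U" "h \<in> U \<inter> S" for g h
    proof -
      have g: "g \<in> G" using gh U(2) by blast
      have "inv\<^bsub>GL\<^esub> g ** h ** g \<in> S"
        using normal.inv_op_closed1[OF S(1), of g h] g gh invG[OF g] by simp
      moreover have "inv\<^bsub>GL\<^esub> g ** h ** g \<in> U"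
        using gh subgroup.m_closed[OF U(1)] subgroup.m_inv_closed[OF U(1)] by (metis IntD1 mult_GL)
      ultimately show ?thesis by blast
    qed
    show "\<exists>m::nat. m > 0 \<and> g [^]\<^bsub>GL\<^esub> m \<in> U \<inter> S" if g: "g \<in> U" for g
    proof -
      obtain m :: nat where m: "m > 0" "g [^]\<^bsub>?G\<^esub> m \<in> S"
        using G.finite_rcosets_power[OF subS S(3), of g] g U(2) by auto
      have "g [^]\<^bsub>GL\<^esub> m \<in> U" by (induction m) (use g subgroup.m_closed[OF U(1)] subgroup.one_closed[OF U(1)] in auto)
      then show ?thesis using m GL.nat_pow_consistent[of g m G] by auto
    qed
  qed auto
qed

section \<open>The unipotent radical as a filtered group\<close>

lemma matrix_add_rdistrib: "(a + b) ** c = a ** c + b ** (c :: 'a::semiring_1 ^ 'n ^ 'm)"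
  by (simp add: matrix_matrix_mult_def vec_eq_iff distrib_right sum.distrib)

text \<open>The multiplication that the type classes give to vectors is componentwise; this copy of the
  square matrices carries the matrix product instead.\<close>

typedef ('a, 'n::finite) sqmat = "UNIV :: ('a ^ 'n ^ 'n) set"
  morphisms matrix_of Sq by auto

setup_lifting type_definition_sqmat

instantiation sqmat :: (field, finite) ring_1
begin

lift_definition zero_sqmat :: "('a, 'b) sqmat" is 0 .
lift_definition one_sqmat :: "('a, 'b) sqmat" is "mat 1" .
lift_definition plus_sqmat :: "('a, 'b) sqmat \<Rightarrow> ('a, 'b) sqmat \<Rightarrow> ('a, 'b) sqmat" is "(+)" .
lift_definition minus_sqmat :: "('a, 'b) sqmat \<Rightarrow> ('a, 'b) sqmat \<Rightarrow> ('a, 'b) sqmat" is "(-)" .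
lift_definition uminus_sqmat :: "('a, 'b) sqmat \<Rightarrow> ('a, 'b) sqmat" is uminus .
lift_definition times_sqmat :: "('a, 'b) sqmat \<Rightarrow> ('a, 'b) sqmat \<Rightarrow> ('a, 'b) sqmat" is "(**)" .

instance
proof
  show "(0::('a, 'b) sqmat) \<noteq> 1"
  proof (transfer, rule notI)
    assume "(0 :: 'a ^ 'b ^ 'b) = mat 1"
    then have "(0 :: 'a ^ 'b ^ 'b) $ i $ i = mat 1 $ i $ i" for i by simp
    then show False by (simp add: mat_def)
  qed
qed (transfer; simp add: matrix_mul_assoc matrix_add_ldistrib matrix_add_rdistrib)+

end

lemma mat_mult_vec: "(mat k ** a) *v v = k *s (a *v (v :: 'a::field ^ 'n))"
  unfolding matrix_vector_mul_assoc[symmetric]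
  by (simp add: vec_eq_iff matrix_vector_mult_def mat_def if_distrib[of "\<lambda>x. x * _"] cong: if_cong)

lemma matrix_eqI: "(\<And>v. a *v v = b *v v) \<Longrightarrow> a = (b :: 'a::field ^ 'n ^ 'm)"
  using matrix_eq by blast

lemma mat_central: "a ** mat k = mat k ** (a :: 'a::field ^ 'n ^ 'n)"
proof (rule matrix_eqI)
  fix v
  have "(mat k ** mat 1) *v v = k *s v" for v :: "'a ^ 'n" unfolding mat_mult_vec by simp
  then have "mat k *v v = k *s v" for v :: "'a ^ 'n" by simp
  then show "(a ** mat k) *v v = (mat k ** a) *v v"
    unfolding mat_mult_vec matrix_vector_mul_assoc[symmetric] by (simp add: vector_scalar_commute)
qed

text \<open>The algebra called J in the overview. Its elements are strictly block triangular along
  any composition series of the module; quantifying over all chief factors avoids a choice of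
  series.\<close>

definition chief_nil :: "('a::field ^ 'n ^ 'n) set \<Rightarrow> ('a ^ 'n ^ 'n) set" where
  "chief_nil G = {a. \<forall>A B. chief G A B \<longrightarrow> (\<forall>v\<in>B. a *v v \<in> A)}"

lemma chief_nilD: "a \<in> chief_nil G \<Longrightarrow> chief G A B \<Longrightarrow> v \<in> B \<Longrightarrow> a *v v \<in> A"
  by (auto simp: chief_nil_def)

lemma chief_subspace: "chief G A B \<Longrightarrow> vec.subspace A"
  by (simp add: chief_def invariant_def)

lemma chief_nil_0: "0 \<in> chief_nil G"
  by (auto simp: chief_nil_def intro: vec.subspace_0 chief_subspace)

lemma chief_nil_add: "a \<in> chief_nil G \<Longrightarrow> b \<in> chief_nil G \<Longrightarrow> a + b \<in> chief_nil G"
  by (auto simp: chief_nil_def matrix_vector_mult_add_rdistrib intro: vec.subspace_add chief_subspace)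

lemma chief_nil_scale: "a \<in> chief_nil G \<Longrightarrow> mat k ** a \<in> chief_nil G"
  by (auto simp: chief_nil_def mat_mult_vec intro: vec.subspace_scale chief_subspace)

lemma chief_nil_mult:
  assumes "a \<in> chief_nil G" "b \<in> chief_nil G" shows "a ** b \<in> chief_nil G"
  unfolding chief_nil_def
proof (intro CollectI allI impI ballI)
  fix A B v assume ch: "chief G A B" and v: "v \<in> B"
  have "b *v v \<in> A" by (rule chief_nilD[OF assms(2) ch v])
  then have "b *v v \<in> B" using ch by (auto simp: chief_def)
  from chief_nilD[OF assms(1) ch this] show "(a ** b) *v v \<in> A" by (simp add: matrix_vector_mul_assoc)
qed

definition chief_kernel :: "('a::field ^ 'n ^ 'n) set \<Rightarrow> ('a ^ 'n ^ 'n) set" where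
  "chief_kernel G = {g \<in> G. g - mat 1 \<in> chief_nil G}"

lemma chief_kernel_iff:
  "g \<in> chief_kernel G \<longleftrightarrow> g \<in> G \<and> (\<forall>A B. chief G A B \<longrightarrow> (\<forall>v\<in>B. g *v v - v \<in> A))"
  by (auto simp: chief_kernel_def chief_nil_def matrix_vector_mult_diff_rdistrib)

text \<open>It is the intersection of the kernels of the actions of G on the chief factors.\<close>

lemma chief_kernel_normal:
  assumes G: "subgroup G GL" shows "chief_kernel G \<lhd> GL\<lparr>carrier := G\<rparr>"
proof -
  interpret G: group "GL\<lparr>carrier := G\<rparr>" by (rule GL.subgroup_imp_group[OF G])
  have GG: "G \<subseteq> carrier GL" by (rule subgroup.subset[OF G])
  have invG: "inv\<^bsub>GL\<lparr>carrier := G\<rparr>\<^esub> g = inv\<^bsub>GL\<^esub> g" if "g \<in> G" for g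
    using GL.m_inv_consistent[OF G that] by simp
  have inv: "inv\<^bsub>GL\<^esub> g \<in> G" if "g \<in> G" for g using subgroup.m_inv_closed[OF G that] .
  have chD: "invariant G A" "invariant G B" "vec.subspace A" "A \<subseteq> B" if "chief G A B" for A B
    using that by (auto simp: chief_def invariant_def)
  have sub: "subgroup (chief_kernel G) (GL\<lparr>carrier := G\<rparr>)"
  proof (rule G.subgroupI)
    show "chief_kernel G \<subseteq> carrier (GL\<lparr>carrier := G\<rparr>)" by (auto simp: chief_kernel_def)
    have "mat 1 \<in> chief_kernel G"
      using subgroup.one_closed[OF G] chief_nil_0 by (simp add: chief_kernel_def)
    then show "chief_kernel G \<noteq> {}" by blast
    fix a assume a: "a \<in> chief_kernel G"
    then have aG: "a \<in> G" by (simp add: chief_kernel_def)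
    have ac: "a \<in> carrier GL" using aG GG by blast
    have "inv\<^bsub>GL\<^esub> a *v v - v \<in> A" if ch: "chief G A B" and v: "v \<in> B" for A B v
    proof -
      have "inv\<^bsub>GL\<^esub> a *v v \<in> B" by (rule invariantD[OF chD(2)[OF ch] inv[OF aG] v])
      then have "a *v (inv\<^bsub>GL\<^esub> a *v v) - inv\<^bsub>GL\<^esub> a *v v \<in> A" using a ch unfolding chief_kernel_iff by blast
      then have "v - inv\<^bsub>GL\<^esub> a *v v \<in> A" using GL_inv_vec(2)[OF ac] by simp
      then show ?thesis using vec.subspace_neg[OF chD(3)[OF ch], of "v - inv\<^bsub>GL\<^esub> a *v v"] by simp
    qed
    then show "inv\<^bsub>GL\<lparr>carrier := G\<rparr>\<^esub> a \<in> chief_kernel G"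
      using inv[OF aG] unfolding chief_kernel_iff invG[OF aG] by blast
    fix b assume b: "b \<in> chief_kernel G"
    then have bG: "b \<in> G" by (simp add: chief_kernel_def)
    have "(a - mat 1) ** (b - mat 1) + (a - mat 1) + (b - mat 1) = a ** b - mat 1"
      by (rule matrix_eqI)
        (simp only: matrix_vector_mul_assoc[symmetric] matrix_vector_mult_diff_rdistrib
          matrix_vector_mult_add_rdistrib matrix_vector_mult_diff_distrib matrix_vector_mul_lid, simp)
    moreover have "(a - mat 1) ** (b - mat 1) + (a - mat 1) + (b - mat 1) \<in> chief_nil G"
      using a b by (intro chief_nil_add chief_nil_mult) (auto simp: chief_kernel_def)
    ultimately show "a \<otimes>\<^bsub>GL\<lparr>carrier := G\<rparr>\<^esub> b \<in> chief_kernel G"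
      using subgroup.m_closed[OF G aG bG] by (simp add: chief_kernel_def)
  qed
  show ?thesis
  proof (rule G.normal_invI[OF sub])
    fix x h assume "x \<in> carrier (GL\<lparr>carrier := G\<rparr>)" and h: "h \<in> chief_kernel G"
    then have x: "x \<in> G" by simp
    have hG: "h \<in> G" using h by (simp add: chief_kernel_def)
    have xc: "x \<in> carrier GL" using x GG by blast
    have "(x ** h ** inv\<^bsub>GL\<^esub> x) *v v - v \<in> A" if ch: "chief G A B" and v: "v \<in> B" for A B v
    proof -
      define w where "w = inv\<^bsub>GL\<^esub> x *v v"
      have "w \<in> B" unfolding w_def by (rule invariantD[OF chD(2)[OF ch] inv[OF x] v])
      then have "h *v w - w \<in> A" using h ch unfolding chief_kernel_iff by blast
      then have "x *v (h *v w - w) \<in> A" by (rule invariantD[OF chD(1)[OF ch] x])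
      moreover have "x *v (h *v w - w) = (x ** h ** inv\<^bsub>GL\<^esub> x) *v v - v"
        using GL_inv_vec(2)[OF xc, of v]
        by (simp add: w_def matrix_vector_mult_diff_distrib matrix_vector_mul_assoc[symmetric])
      ultimately show ?thesis by simp
    qed
    moreover have "x ** h ** inv\<^bsub>GL\<^esub> x \<in> G"
      using subgroup.m_closed[OF G subgroup.m_closed[OF G x hG] inv[OF x]] by simp
    ultimately have "x ** h ** inv\<^bsub>GL\<^esub> x \<in> chief_kernel G" unfolding chief_kernel_iff by blast
    then show "x \<otimes>\<^bsub>GL\<lparr>carrier := G\<rparr>\<^esub> h \<otimes>\<^bsub>GL\<lparr>carrier := G\<rparr>\<^esub> inv\<^bsub>GL\<lparr>carrier := G\<rparr>\<^esub> x \<in> chief_kernel G"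
      using invG[OF x] by simp
  qed
qed

text \<open>Clifford's argument for U in G: the fixed vectors of U in a chief factor of G form a
  nonzero submodule, hence the whole factor.\<close>

lemma unipotent_normal_subset_chief_kernel:
  fixes G :: "('a::field_char_0 ^ 'n ^ 'n) set"
  assumes G: "subgroup G GL" and sf: "solvable_by_finite (GL\<lparr>carrier := G\<rparr>)"
    and U: "U \<lhd> GL\<lparr>carrier := G\<rparr>" "\<And>u. u \<in> U \<Longrightarrow> unipotent_matrix u"
  shows "U \<subseteq> chief_kernel G"
proof
  have subU: "subgroup U (GL\<lparr>carrier := G\<rparr>)" using U(1) normal_imp_subgroup by blast
  have UG: "U \<subseteq> G" using subgroup.subset[OF subU] by simp
  have UGL: "subgroup U GL" by (rule GL.incl_subgroup[OF G subU])
  have fixed: "has_fixed_vectors U" by (rule solvable_by_finite_unipotent_fixed[OF G sf UGL UG U(2)])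
  have norm: "inv\<^bsub>GL\<^esub> g ** h ** g \<in> U" if "g \<in> G" "h \<in> U" for g h
    using normal.inv_op_closed1[OF U(1), of g h] that GL.m_inv_consistent[OF G that(1)] by simp
  fix u assume u: "u \<in> U"
  show "u \<in> chief_kernel G"
    unfolding chief_kernel_iff
  proof (intro conjI allI impI ballI)
    show "u \<in> G" using u UG by blast
    fix A B v assume ch: "chief G A B" and v: "v \<in> B"
    show "u *v v - v \<in> A"
      by (rule chief_fixed[OF subgroup.subset[OF G] ch UG fixed norm v u])
  qed
qed

section \<open>Rational functionals and the flag of the nilpotent algebra\<close>

definition rat_linear :: "('a::field_char_0 ^ 'n ^ 'n \<Rightarrow> rat) \<Rightarrow> bool" where
  "rat_linear l \<longleftrightarrow> (\<forall>a b. l (a + b) = l a + l b) \<and> (\<forall>q a. l (mat (of_rat q) ** a) = q * l a)"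

lemma rat_functional:
  fixes z :: "'a::field_char_0"
  assumes "z \<noteq> 0"
  obtains \<psi> :: "'a \<Rightarrow> rat" where "\<And>x y. \<psi> (x + y) = \<psi> x + \<psi> y" "\<And>q x. \<psi> (of_rat q * x) = q * \<psi> x" "\<psi> z \<noteq> 0"
proof -
  interpret vector_space_pair "\<lambda>q (x::'a). of_rat q * x" "(*) :: rat \<Rightarrow> rat \<Rightarrow> rat"
    by unfold_locales (auto simp: algebra_simps of_rat_add of_rat_mult)
  have "vs1.independent {z}" using assms by simp
  from linear_independent_extend[OF this, of "\<lambda>_. 1"]
  obtain \<psi> where lin: "Vector_Spaces.linear (\<lambda>q (x::'a). of_rat q * x) ((*) :: rat \<Rightarrow> rat \<Rightarrow> rat) \<psi>" and z: "\<psi> z = 1" by auto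
  interpret l: Vector_Spaces.linear "\<lambda>q (x::'a). of_rat q * x" "(*) :: rat \<Rightarrow> rat \<Rightarrow> rat" \<psi> by (rule lin)
  show ?thesis by (rule that[of \<psi>]) (simp_all add: l.add l.scale z)
qed

text \<open>Let B be a largest submodule killed by W and B'/B a chief factor above it. Some b in B'
  is not killed by W, but a b lies in B for every a in the algebra, so W a b = 0. A rational
  functional of a coordinate of w b then has the required properties.\<close>

lemma rat_functional_chief_nil:
  fixes W :: "('a::field_char_0 ^ 'n ^ 'n) set"
  assumes w: "w \<in> W" "w \<noteq> 0"
  obtains l where "rat_linear l" "\<exists>w\<in>W. l w \<noteq> 0" "\<And>w b. w \<in> W \<Longrightarrow> b \<in> chief_nil G \<Longrightarrow> l (w ** b) = 0"
proof -
  define P where "P B \<longleftrightarrow> invariant G B \<and> (\<forall>w\<in>W. \<forall>b\<in>B. w *v b = 0)" for B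
  have P0: "P {0}" by (simp add: P_def invariant_0)
  have bd: "\<forall>B. P B \<longrightarrow> vec.dim B < Suc (vec.dim (UNIV :: ('a ^ 'n) set))"
    using vec.dim_subset[OF subset_UNIV] by (auto simp: less_Suc_eq_le)
  obtain B where B: "P B" and max: "\<And>C. P C \<Longrightarrow> vec.dim C \<le> vec.dim B"
    \<comment> \<open>Dimensions are bounded by that of the whole space, and the zero space
      qualifies.\<close>
    using ex_has_greatest_nat[OF P0 bd] by blast
  have "B \<noteq> UNIV"
  proof
    assume "B = UNIV"
    then have "w = 0" using B w(1) by (intro matrix_eqI) (auto simp: P_def)
    then show False using w(2) by simp
  qed
  then obtain B' where ch: "chief G B B'"
    using chief_above[of G B UNIV] B invariant_UNIV by (auto simp: P_def)
  have "\<not> P B'"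
  proof
    assume "P B'"
    then show False using max[of B'] dim_invariant_less[of G B B'] ch B unfolding chief_def P_def
      by (metis not_le)
  qed
  then obtain w' b where wb: "w' \<in> W" "b \<in> B'" "w' *v b \<noteq> 0" using ch by (auto simp: P_def chief_def)
  then obtain k where "(w' *v b) $ k \<noteq> 0" by (auto simp: vec_eq_iff)
  then obtain \<psi> :: "'a \<Rightarrow> rat" where psi: "\<And>x y. \<psi> (x + y) = \<psi> x + \<psi> y"
    "\<And>q x. \<psi> (of_rat q * x) = q * \<psi> x" "\<psi> ((w' *v b) $ k) \<noteq> 0" by (rule rat_functional) blast
  have psi0: "\<psi> 0 = 0" using psi(1)[of 0 0] by simp
  define l where "l a = \<psi> ((a *v b) $ k)" for a
  have "rat_linear l"
    by (simp add: rat_linear_def l_def mat_mult_vec matrix_vector_mult_add_rdistrib psi)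
  moreover have "\<exists>w\<in>W. l w \<noteq> 0" using wb psi by (auto simp: l_def)
  moreover have "l (u ** a) = 0" if u: "u \<in> W" and a: "a \<in> chief_nil G" for u a
  proof -
    have "a *v b \<in> B" by (rule chief_nilD[OF a ch wb(2)])
    then have "u *v (a *v b) = 0" using B u by (auto simp: P_def)
    then show ?thesis by (simp add: l_def matrix_vector_mul_assoc psi0)
  qed
  ultimately show ?thesis using that by blast
qed

lemma mat_mult_nth: "(mat k ** a) $ i $ j = k * (a :: 'a::field ^ 'n ^ 'n) $ i $ j"
  by (simp add: matrix_matrix_mult_def mat_def if_distrib[of "\<lambda>x. x * _"] cong: if_cong)

lemma mat_add: "mat (p + q) = mat p + (mat q :: 'a::field ^ 'n ^ 'n)"
  by (simp add: mat_def vec_eq_iff)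

lemma mat_mult_mat: "mat (p * q) = mat p ** (mat q :: 'a::field ^ 'n ^ 'n)"
  by (simp add: vec_eq_iff mat_mult_nth) (simp add: mat_def)

lemma vector_space_rat_matrix:
  "vector_space (\<lambda>q (a :: 'a::field_char_0 ^ 'n ^ 'n). mat (of_rat q) ** a)"
  by unfold_locales
    (simp_all add: of_rat_add of_rat_mult mat_add mat_mult_mat matrix_add_ldistrib matrix_add_rdistrib matrix_mul_assoc)

lemma finite_dimensional_rat_matrix:
  assumes "number_field TYPE('a::field_char_0)"
  obtains Basis where
    "finite_dimensional_vector_space (\<lambda>q (a :: 'a ^ 'n ^ 'n). mat (of_rat q) ** a) Basis"
proof -
  obtain B where B: "finite_dimensional_vector_space (\<lambda>(q::rat) (x::'a). of_rat q * x) B"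
    using assms by (auto simp: number_field_def)
  interpret F: finite_dimensional_vector_space "\<lambda>(q::rat) (x::'a). of_rat q * x" B by (rule B)
  interpret M: vector_space "\<lambda>q (a :: 'a ^ 'n ^ 'n). mat (of_rat q) ** a" by (rule vector_space_rat_matrix)
  define E :: "'n \<Rightarrow> 'n \<Rightarrow> 'a \<Rightarrow> 'a ^ 'n ^ 'n" where "E i j z = (\<chi> k l. if k = i \<and> l = j then z else 0)" for i j z
  define T where "T = (\<lambda>(i, j, b). E i j b) ` (UNIV \<times> UNIV \<times> B)"
  have T: "finite T" unfolding T_def using F.finite_Basis by simp
  have E: "E i j z \<in> M.span T" for i j z
  proof -
    have "z \<in> F.span B" by (simp add: F.span_Basis)
    then show ?thesis
    proof (induction rule: F.span_induct_alt)
      case base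
      have "E i j 0 = 0" by (simp add: E_def vec_eq_iff)
      then show ?case using M.span_zero by simp
    next
      case (step q x y)
      have "E i j x \<in> M.span T" using step(1) unfolding T_def by (intro M.span_base) force
      moreover have "E i j (of_rat q * x + y) = mat (of_rat q) ** E i j x + E i j y"
        by (simp add: vec_eq_iff mat_mult_nth) (simp add: E_def)
      ultimately show ?case using step(2) M.span_add M.span_scale by metis
    qed
  qed
  have "a \<in> M.span T" for a
  proof -
    have "a = (\<Sum>i\<in>UNIV. \<Sum>j\<in>UNIV. E i j (a $ i $ j))"
    proof -
      have "(\<Sum>i\<in>UNIV. \<Sum>j\<in>UNIV. E i j (a $ i $ j)) $ k $ l = a $ k $ l" for k l
      proof -
        have "(\<Sum>i\<in>UNIV. \<Sum>j\<in>UNIV. E i j (a $ i $ j)) $ k $ l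
            = (\<Sum>i\<in>UNIV. \<Sum>j\<in>UNIV. if k = i \<and> l = j then a $ i $ j else 0)"
          by (simp add: E_def)
        also have "\<dots> = (\<Sum>i\<in>UNIV. if k = i then (\<Sum>j\<in>UNIV. if l = j then a $ i $ j else 0) else 0)"
          by (intro sum.cong refl) (simp split: if_split)
        finally show ?thesis by simp
      qed
      then show ?thesis by (simp add: vec_eq_iff)
    qed
    moreover have "(\<Sum>i\<in>UNIV. \<Sum>j\<in>UNIV. E i j (a $ i $ j)) \<in> M.span T"
      by (intro M.span_sum E)
    ultimately show ?thesis by simp
  qed
  then have spanT: "M.span T = UNIV" by blast
  obtain C where C: "C \<subseteq> T" "M.independent C" "T \<subseteq> M.span C" by (rule M.maximal_independent_subset)
  have "M.span C = UNIV" using M.span_minimal[OF C(3) M.subspace_span] spanT by auto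
  then have "finite_dimensional_vector_space (\<lambda>q (a :: 'a ^ 'n ^ 'n). mat (of_rat q) ** a) C"
    using C finite_subset[OF C(1) T] by unfold_locales auto
  then show ?thesis by (rule that)
qed

text \<open>A full flag of rational subspaces of W, each mapped into the next by right multiplication
  with the algebra, is built from the top: the first functional vanishes on the products.\<close>

lemma rational_flag:
  fixes W :: "('a::field_char_0 ^ 'n ^ 'n) set"
  assumes nf: "number_field TYPE('a)"
    and W: "0 \<in> W" "\<And>a b. a \<in> W \<Longrightarrow> b \<in> W \<Longrightarrow> a + b \<in> W" "\<And>q a. a \<in> W \<Longrightarrow> mat (of_rat q) ** a \<in> W"
    and WJ: "\<And>a b. a \<in> W \<Longrightarrow> b \<in> chief_nil G \<Longrightarrow> a ** b \<in> W"
  shows "\<exists>c d. (\<forall>i. rat_linear (c i)) \<and>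
    (\<forall>a\<in>W. \<forall>b\<in>chief_nil G. \<forall>i::nat. (\<forall>j<i. c j a = 0) \<longrightarrow> c i (a ** b) = 0) \<and>
    (\<forall>a\<in>W. (\<forall>j<d. c j a = 0) \<longrightarrow> a = 0)"
proof -
  obtain Basis where "finite_dimensional_vector_space (\<lambda>q (a :: 'a ^ 'n ^ 'n). mat (of_rat q) ** a) Basis"
    using finite_dimensional_rat_matrix[OF nf] .
  then interpret M: finite_dimensional_vector_space "\<lambda>q (a :: 'a ^ 'n ^ 'n). mat (of_rat q) ** a" Basis .
  have "M.subspace W" using W by (intro M.subspaceI)
  then show ?thesis using WJ
  proof (induction "M.dim W" arbitrary: W rule: less_induct)
    case less
    show ?case
    proof (cases "W \<subseteq> {0}")
      case True
      have "rat_linear (\<lambda>_. 0)" by (simp add: rat_linear_def)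
      then show ?thesis using True by (intro exI[of _ "\<lambda>_ _. 0"] exI[of _ 0]) auto
    next
      case False
      then obtain w where w: "w \<in> W" "w \<noteq> 0" by blast
      obtain l where l: "rat_linear l" "\<exists>w\<in>W. l w \<noteq> 0"
        "\<And>w b. w \<in> W \<Longrightarrow> b \<in> chief_nil G \<Longrightarrow> l (w ** b) = 0"
        using rat_functional_chief_nil[OF w, of G] by blast
      \<comment> \<open>The next member of the flag. Since \<open>l\<close> kills the products of
        \<open>W\<close> with the algebra, these lie in V; so V is again stable and the induction on
        dimension applies.\<close>
      define V where "V = {a \<in> W. l a = 0}"
      have l0: "l 0 = 0" using l(1) unfolding rat_linear_def by (metis add_cancel_right_right)
      have V: "M.subspace V"
        using less(2) l(1) l0 unfolding V_def rat_linear_def M.subspace_def by auto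
      have "V \<subset> W" using l(2) by (auto simp: V_def)
      then have dim: "M.dim V < M.dim W"
        using M.subspace_dim_equal[OF V less(2)] by (metis not_le psubset_eq)
      have VJ: "a ** b \<in> V" if "a \<in> V" "b \<in> chief_nil G" for a b
        using that less(3) l(3) by (auto simp: V_def)
      have "\<exists>c d. (\<forall>i. rat_linear (c i)) \<and>
        (\<forall>a\<in>V. \<forall>b\<in>chief_nil G. \<forall>i::nat. (\<forall>j<i. c j a = 0) \<longrightarrow> c i (a ** b) = 0) \<and>
        (\<forall>a\<in>V. (\<forall>j<d. c j a = 0) \<longrightarrow> a = 0)"
        by (rule less(1)[OF dim V]) (rule VJ)
      then obtain c d where c: "\<forall>i. rat_linear (c i)"
        "\<forall>a\<in>V. \<forall>b\<in>chief_nil G. \<forall>i::nat. (\<forall>j<i. c j a = 0) \<longrightarrow> c i (a ** b) = 0"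
        "\<forall>a\<in>V. (\<forall>j<d. c j a = 0) \<longrightarrow> a = 0"
        by (elim exE conjE) (rule that; assumption)
      \<comment> \<open>\<open>l\<close> is put in front of the functionals for V, which shifts
        their indices and the length by one.\<close>
      let ?c = "case_nat l c"
      have tail: "a \<in> V \<and> (\<forall>j<i. c j a = 0)" if a: "a \<in> W" and 0: "\<forall>j<Suc i. ?c j a = 0" for a i
      proof -
        have "l a = 0" using 0[rule_format, of 0] by simp
        moreover have "c j a = 0" if "j < i" for j using 0[rule_format, of "Suc j"] that by simp
        ultimately show ?thesis using a by (simp add: V_def)
      qed
      have "\<forall>i. rat_linear (?c i)" using c(1) l(1) by (simp split: nat.split)
      moreover have "?c i (a ** b) = 0" if "a \<in> W" "b \<in> chief_nil G" "\<forall>j<i. ?c j a = 0" for a b i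
      proof (cases i)
        case 0
        then show ?thesis using l(3) that by simp
      next
        case (Suc k)
        then show ?thesis using tail[of a k] that c(2) by simp
      qed
      moreover have "a = 0" if "a \<in> W" "\<forall>j<Suc d. ?c j a = 0" for a
        using tail[OF that] c(3) by blast
      ultimately show ?thesis by (intro exI[of _ ?c] exI[of _ "Suc d"]) blast
    qed
  qed
qed

lemma matrix_of_Sq [simp]: "matrix_of (Sq a) = a"
  by (simp add: Sq_inverse)

lemma filtered_group_chief_nil:
  fixes G :: "('a::field_char_0 ^ 'n ^ 'n) set"
  assumes nf: "number_field TYPE('a)"
  shows "\<exists>c d. filtered_group (\<lambda>q. Sq (mat (of_rat q))) {a. matrix_of a \<in> chief_nil G} c d GL Sq"
proof -
  obtain c d where c: "\<forall>i. rat_linear (c i)"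
    "\<forall>a\<in>chief_nil G. \<forall>b\<in>chief_nil G. \<forall>i::nat. (\<forall>j<i. c j a = 0) \<longrightarrow> c i (a ** b) = 0"
    "\<forall>a\<in>chief_nil G. (\<forall>j<d. c j a = 0) \<longrightarrow> a = 0"
  proof -
    have "\<exists>c d. (\<forall>i. rat_linear (c i)) \<and>
      (\<forall>a\<in>chief_nil G. \<forall>b\<in>chief_nil G. \<forall>i::nat. (\<forall>j<i. c j a = 0) \<longrightarrow> c i (a ** b) = 0) \<and>
      (\<forall>a\<in>chief_nil G. (\<forall>j<d. c j a = 0) \<longrightarrow> a = 0)"
      by (rule rational_flag[OF nf])
        (auto intro: chief_nil_0 chief_nil_add chief_nil_scale chief_nil_mult)
    then show ?thesis by (elim exE conjE) (rule that; assumption)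
  qed
  have lin: "c i (a + b) = c i a + c i b" "c i (mat (of_rat q) ** a) = q * c i a" for i a b q
    using c(1) by (auto simp: rat_linear_def)
  have "filtered_algebra (\<lambda>q. Sq (mat (of_rat q))) {a. matrix_of a \<in> chief_nil G} (\<lambda>i a. c i (matrix_of a)) d"
  proof
    fix p q :: rat and a b :: "('a, 'n) sqmat" and i
    show "Sq (mat (of_rat (p + q))) = Sq (mat (of_rat p)) + (Sq (mat (of_rat q)) :: ('a, 'n) sqmat)"
      by (simp add: matrix_of_inject[symmetric] plus_sqmat.rep_eq of_rat_add mat_add)
    show "Sq (mat (of_rat (p * q))) = Sq (mat (of_rat p)) * (Sq (mat (of_rat q)) :: ('a, 'n) sqmat)"
      by (simp add: matrix_of_inject[symmetric] times_sqmat.rep_eq of_rat_mult mat_mult_mat)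
    show "Sq (mat (of_rat 1)) = (1 :: ('a, 'n) sqmat)"
      by (simp add: matrix_of_inject[symmetric] one_sqmat.rep_eq)
    show "a * Sq (mat (of_rat q)) = Sq (mat (of_rat q)) * a"
      by (simp add: matrix_of_inject[symmetric] times_sqmat.rep_eq mat_central)
    show "a = 0" if "a \<in> {a. matrix_of a \<in> chief_nil G}" "\<forall>j<d. c j (matrix_of a) = 0"
      using that c(3) by (simp add: matrix_of_inject[symmetric] zero_sqmat.rep_eq)
  qed (use c(2) in \<open>auto simp: lin zero_sqmat.rep_eq plus_sqmat.rep_eq times_sqmat.rep_eq
      intro: chief_nil_0 chief_nil_add chief_nil_mult chief_nil_scale\<close>)
  moreover have "filtered_group_axioms GL (Sq :: 'a ^ 'n ^ 'n \<Rightarrow> _)"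
    by unfold_locales (simp_all add: matrix_of_inject[symmetric] times_sqmat.rep_eq one_sqmat.rep_eq)
  ultimately show ?thesis using filtered_group.intro group_GL by blast
qed

text \<open>Nilpotency is read off from the rational flag: (g - 1)^(d+1) = 0, with d the length of
  the flag.\<close>

lemma chief_kernel_unipotent:
  fixes G :: "('a::field_char_0 ^ 'n ^ 'n) set"
  assumes nf: "number_field TYPE('a)" and g: "g \<in> chief_kernel G"
  shows "unipotent_matrix g"
proof -
  obtain c d where "filtered_group (\<lambda>q. Sq (mat (of_rat q))) {a. matrix_of a \<in> chief_nil G} c d
      (GL :: ('a ^ 'n ^ 'n) monoid) Sq"
    using filtered_group_chief_nil[OF nf] by blast
  then interpret filtered_group "\<lambda>q. Sq (mat (of_rat q))" "{a. matrix_of a \<in> chief_nil G}" c d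
    "GL :: ('a ^ 'n ^ 'n) monoid" Sq .
  have iter: "(((**) (g - mat 1)) ^^ k) (mat 1) = matrix_of (Sq (g - mat 1) ^ k)" for k
    by (induction k) (simp_all add: one_sqmat.rep_eq times_sqmat.rep_eq)
  have "Sq (g - mat 1) ^ Suc d = 0"
    by (rule power_eq_0) (use g in \<open>simp add: chief_kernel_def\<close>)
  then have "(((**) (g - mat 1)) ^^ Suc d) (mat 1) = 0"
    unfolding iter by (simp only: zero_sqmat.rep_eq)
  then show ?thesis unfolding unipotent_matrix_def by blast
qed

text \<open>\<open>GREATEST\<close> has a usable value only if a largest unipotent normal subgroup
  exists; the kernel of the action on the chief factors is one.\<close>

lemma unipotent_radical_eq:
  fixes G :: "('a::field_char_0 ^ 'n ^ 'n) set"
  assumes nf: "number_field TYPE('a)" and G: "subgroup G GL" and sf: "solvable_by_finite (GL\<lparr>carrier := G\<rparr>)"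
  shows "unipotent_radical G = chief_kernel G"
  unfolding unipotent_radical_def
  using chief_kernel_normal[OF G] chief_kernel_unipotent[OF nf] unipotent_normal_subset_chief_kernel[OF G sf]
  by (intro Greatest_equality) blast+

theorem lemma3p9:
  fixes G N :: "('a::field_char_0 ^ 'n ^ 'n) set"
    and x :: "nat \<Rightarrow> 'a ^ 'n ^ 'n" and r t :: nat
    and Y :: "('a ^ 'n ^ 'n) set"
    and H Ys :: "nat \<Rightarrow> ('a ^ 'n ^ 'n) set"
  assumes "number_field TYPE('a)"
    and "\<And>k. k \<in> {1..r} \<Longrightarrow> x k \<in> carrier GL"
    and "G = generate GL (x ` {1..r})"
    and "solvable_by_finite (GL\<lparr>carrier := G\<rparr>)"
    and "finite Y" and "Y \<subseteq> unipotent_radical G"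
    and "N = normal_closure (GL\<lparr>carrier := G\<rparr>) (generate GL Y)"
    and "H 1 = generate GL Y"
    and "\<And>i. i \<ge> 1 \<Longrightarrow> finite (Ys i) \<and> H i = generate GL (Ys i)"
    and "\<And>i. i \<ge> 1 \<Longrightarrow> H (Suc i) = generate GL
           (Ys i \<union> {conjugate GL y (x k) | y k. y \<in> Ys i \<and> k \<in> {1..r}}
                \<union> {conjugate GL y (inv\<^bsub>GL\<^esub> (x k)) | y k. y \<in> Ys i \<and> k \<in> {1..r}})"
    and "t \<ge> 1"
    and "pruefer_rank (GL\<lparr>carrier := H t\<rparr>) = pruefer_rank (GL\<lparr>carrier := H (Suc t)\<rparr>)"
  shows "pruefer_rank (GL\<lparr>carrier := H t\<rparr>) = pruefer_rank (GL\<lparr>carrier := N\<rparr>)"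
proof -
  note nf = assms(1) and xGL = assms(2) and N = assms(7) and HYs = assms(9) and HSuc = assms(10)
  have xs: "x ` {1..r} \<subseteq> carrier GL" using xGL by auto
  have G: "subgroup G GL" unfolding assms(3) by (rule GL.generate_is_subgroup[OF xs])
  let ?G = "GL\<lparr>carrier := G\<rparr>"
  interpret G: group ?G by (rule GL.subgroup_imp_group[OF G])
  have GG: "G \<subseteq> carrier GL" by (rule subgroup.subset[OF G])
  have xG: "x k \<in> G" "inv\<^bsub>GL\<^esub> x k \<in> G" if "k \<in> {1..r}" for k
    unfolding assms(3) using that by (auto intro: generate.incl generate.inv)
  have invG: "inv\<^bsub>?G\<^esub> g = inv\<^bsub>GL\<^esub> g" if "g \<in> G" for g
    using GL.m_inv_consistent[OF G that] by simp
  define M where "M = chief_kernel G"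
  have M: "M \<lhd> ?G" unfolding M_def by (rule chief_kernel_normal[OF G])
  have MGL: "subgroup M GL" using GL.incl_subgroup[OF G normal_imp_subgroup[OF M]] .
  have YM: "Y \<subseteq> M" using assms(6) unipotent_radical_eq[OF nf G assms(4)] by (simp add: M_def)
  obtain c d where "filtered_group (\<lambda>q. Sq (mat (of_rat q))) {a. matrix_of a \<in> chief_nil G} c d
      (GL :: ('a ^ 'n ^ 'n) monoid) Sq"
    using filtered_group_chief_nil[OF nf] by blast
  then interpret filtered_group "\<lambda>q. Sq (mat (of_rat q))" "{a. matrix_of a \<in> chief_nil G}" c d
    "GL :: ('a ^ 'n ^ 'n) monoid" Sq .
  have uM: "unip M"
    using MGL by (auto simp: unip_def \<delta>_def M_def chief_kernel_def minus_sqmat.rep_eq one_sqmat.rep_eq)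
  have conj_closed: "conjugate GL y g \<in> K" if K: "K \<lhd> ?G" and y: "y \<in> K" and g: "g \<in> G" for K y g
    using normal.inv_op_closed1[OF K, of g y] y g invG[OF g] by (simp add: conjugate_def)
  \<comment> \<open>Stated for an arbitrary normal subgroup K, for two uses: K = \<open>M\<close>
    makes all \<open>H i\<close> unipotent, and the members of the intersection that defines
    \<open>N\<close> give \<open>H t \<subseteq> N\<close>.\<close>
  have H_in: "H i \<subseteq> K" if K: "K \<lhd> ?G" and YK: "generate GL Y \<subseteq> K" and i: "i \<ge> 1" for K i
    using i
  proof (induction i rule: dec_induct)
    case base
    then show ?case using YK assms(8) by simp
  next
    case (step i)
    have "Ys i \<subseteq> K" using HYs[OF step(1)] step.IH generate.incl by fast
    then have "Ys i \<union> {conjugate GL y (x k) | y k. y \<in> Ys i \<and> k \<in> {1..r}}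
        \<union> {conjugate GL y (inv\<^bsub>GL\<^esub> (x k)) | y k. y \<in> Ys i \<and> k \<in> {1..r}} \<subseteq> K"
      using conj_closed[OF K] xG by blast
    then show ?case unfolding HSuc[OF step(1)]
      by (rule GL.generate_subgroup_incl[OF _ GL.incl_subgroup[OF G normal_imp_subgroup[OF K]]])
  qed
  have genYM: "generate GL Y \<subseteq> M" by (rule GL.generate_subgroup_incl[OF YM MGL])
  have HM: "H i \<subseteq> M" if "i \<ge> 1" for i by (rule H_in[OF M genYM that])
  have YsM: "Ys t \<subseteq> M" using HM[OF assms(11)] HYs[OF assms(11)] generate.incl by fast
  have Ht: "H t = generate GL (Ys t)" and fin: "finite (Ys t)" using HYs[OF assms(11)] by auto
  have uHt: "unip (H t)" unfolding Ht by (rule unip_generate[OF uM YsM])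
  have t1: "Suc t \<ge> 1" by simp
  have subHt1: "subgroup (H (Suc t)) GL"
  proof -
    have "Ys (Suc t) \<subseteq> carrier GL"
      using HM[OF t1] HYs[OF t1] generate.incl unipD(1)[OF uM] by fast
    then show ?thesis using HYs[OF t1] GL.generate_is_subgroup by simp
  qed
  have uHt1: "unip (H (Suc t))" by (rule unip_subgroup[OF uM subHt1 HM[OF t1]])
  have mono: "H i \<subseteq> H (Suc i)" if "i \<ge> 1" for i
    unfolding HSuc[OF that] conjunct2[OF HYs[OF that]] by (rule GL.mono_generate) blast
  have HtHt1: "H t \<subseteq> H (Suc t)" by (rule mono[OF assms(11)])
  have H1Ht: "generate GL Y \<subseteq> H t"
    using assms(11)
  proof (induction t rule: dec_induct)
    case (step i)
    then show ?case using mono by blast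
  qed (use assms(8) in simp)
  \<comment> \<open>Equal ranks give equally many jumps; the inclusion of the groups upgrades this
    to the same set of jumps.\<close>
  have "card (jumps (H t)) = card (jumps (H (Suc t)))"
    using assms(12) pruefer_rank_eq[OF uHt] pruefer_rank_eq[OF uHt1] by simp
  then have "jumps (H (Suc t)) = jumps (H t)"
    using card_subset_eq[OF finite_jumps jumps_mono[OF HtHt1]] by simp
  then have cl: "Sq ` H (Suc t) \<subseteq> zariski_closure (Sq ` generate GL (Ys t))"
    using jumps_eq_imp_closure[OF uHt uHt1 HtHt1] unfolding Ht by simp
  \<comment> \<open>The candidate for a normal subgroup between \<open>N\<close> and the closure of
    \<open>H t\<close>.\<close>
  define C where "C = closure_in M (generate GL (Ys t))"
  have subC: "subgroup C GL" unfolding C_def by (rule subgroup_closure_in[OF uM uHt[unfolded Ht]])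
  have CM: "C \<subseteq> M" by (auto simp: C_def closure_in_def)
  have HtC: "H t \<subseteq> C"
    using HM[OF assms(11)] zariski_closure_superset[of "Sq ` generate GL (Ys t)"]
    unfolding C_def closure_in_def Ht by blast
  have CxC: "w \<otimes>\<^bsub>GL\<^esub> g \<otimes>\<^bsub>GL\<^esub> inv\<^bsub>GL\<^esub> w \<in> C"
    if w: "w \<in> G" and y: "\<And>y. y \<in> Ys t \<Longrightarrow> w \<otimes>\<^bsub>GL\<^esub> y \<otimes>\<^bsub>GL\<^esub> inv\<^bsub>GL\<^esub> w \<in> H (Suc t)" and g: "g \<in> C" for w g
  proof -
    have "w \<otimes>\<^bsub>GL\<^esub> m \<otimes>\<^bsub>GL\<^esub> inv\<^bsub>GL\<^esub> w \<in> M" if "m \<in> M" for m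
      using normal.inv_op_closed2[OF M, of w m] that w invG[OF w] by simp
    then show ?thesis
      using closure_in_conjugate[OF uM _ YsM subHt1 cl y] w GG g unfolding C_def by blast
  qed
  \<comment> \<open>The two conventions are opposite: \<open>conjugate\<close> puts the inverse on
    the left, so w y w^-1 for w = \<open>x k\<close> comes from the conjugate by the inverse
    generator, and vice versa.\<close>
  have xc: "x k \<otimes>\<^bsub>GL\<^esub> y \<otimes>\<^bsub>GL\<^esub> inv\<^bsub>GL\<^esub> x k \<in> H (Suc t)"
    "inv\<^bsub>GL\<^esub> x k \<otimes>\<^bsub>GL\<^esub> y \<otimes>\<^bsub>GL\<^esub> inv\<^bsub>GL\<^esub> (inv\<^bsub>GL\<^esub> x k) \<in> H (Suc t)"
    if k: "k \<in> {1..r}" and y: "y \<in> Ys t" for k y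
  proof -
    have "conjugate GL y (x k) \<in> H (Suc t)" "conjugate GL y (inv\<^bsub>GL\<^esub> x k) \<in> H (Suc t)"
      unfolding HSuc[OF assms(11)] using k y by (auto intro!: generate.incl)
    then show "x k \<otimes>\<^bsub>GL\<^esub> y \<otimes>\<^bsub>GL\<^esub> inv\<^bsub>GL\<^esub> x k \<in> H (Suc t)"
      "inv\<^bsub>GL\<^esub> x k \<otimes>\<^bsub>GL\<^esub> y \<otimes>\<^bsub>GL\<^esub> inv\<^bsub>GL\<^esub> (inv\<^bsub>GL\<^esub> x k) \<in> H (Suc t)"
      using xGL[OF k] by (simp_all add: conjugate_def)
  qed
  have Cn: "C \<lhd> ?G"
  proof (rule G.normal_invI)
    show "subgroup C ?G"
      using GL.subgroup_incl[OF subC G] CM by (auto simp: M_def chief_kernel_def)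
    fix w g assume w: "w \<in> carrier ?G" and g: "g \<in> C"
    then have w: "w \<in> generate GL (x ` {1..r})" and wG: "w \<in> G" using assms(3) by auto
    have "w \<otimes>\<^bsub>GL\<^esub> g \<otimes>\<^bsub>GL\<^esub> inv\<^bsub>GL\<^esub> w \<in> C"
    proof (rule normalised_generate[OF xs subgroup.subset[OF subC] _ _ w g])
      fix v g assume "v \<in> x ` {1..r}" and g: "g \<in> C"
      then obtain k where k: "k \<in> {1..r}" "v = x k" by blast
      show "v \<otimes>\<^bsub>GL\<^esub> g \<otimes>\<^bsub>GL\<^esub> inv\<^bsub>GL\<^esub> v \<in> C"
        unfolding k(2) by (rule CxC[OF xG(1)[OF k(1)] xc(1)[OF k(1)] g])
      show "inv\<^bsub>GL\<^esub> v \<otimes>\<^bsub>GL\<^esub> g \<otimes>\<^bsub>GL\<^esub> inv\<^bsub>GL\<^esub> (inv\<^bsub>GL\<^esub> v) \<in> C"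
        unfolding k(2) by (rule CxC[OF xG(2)[OF k(1)] xc(2)[OF k(1)] g])
    qed
    then show "w \<otimes>\<^bsub>?G\<^esub> g \<otimes>\<^bsub>?G\<^esub> inv\<^bsub>?G\<^esub> w \<in> C" using invG[OF wG] by simp
  qed
  have NC: "N \<subseteq> C" unfolding N normal_closure_def using Cn H1Ht HtC by blast
  have HtN: "H t \<subseteq> N" unfolding N normal_closure_def using H_in[OF _ _ assms(11)] by blast
  have subN: "subgroup N GL"
  proof -
    have "subgroup N ?G"
      unfolding N normal_closure_def
      by (rule G.subgroups_Inter) (use normal_imp_subgroup M genYM in blast)+
    then show ?thesis by (rule GL.incl_subgroup[OF G])
  qed
  have uN: "unip N" using unip_subgroup[OF uM subN] NC CM by blast
  \<comment> \<open>Only \<open>H t\<close> has to be finitely generated here; \<open>N\<close>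
    enters merely as a subgroup inside its closure.\<close>
  have "jumps N \<subseteq> jumps (H t)"
    unfolding Ht
  proof (rule closure_imp_jumps[OF uM fin YsM])
    show "Sq ` N \<subseteq> zariski_closure (Sq ` generate GL (Ys t))"
      using NC by (auto simp: C_def closure_in_def)
  qed
  then have "jumps N = jumps (H t)" using jumps_mono[OF HtN] by blast
  then show ?thesis using pruefer_rank_eq[OF uHt] pruefer_rank_eq[OF uN] by simp
qed

end
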